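(* Let $F\subset[0,1]$ be the Cantor set, $E=F\times F\subset\mathbb R^2$, and for $\delta\in(0,1)$ let $\mathscr E_\delta$, $\Gamma_\delta$, $d_\delta$ be the Dirichlet form, energy measure and intrinsic distance on $\mathbb R^2$ described in the context, with domain $\mathbb D=W^{1,2}(\mathbb R^2)$ and $m$ Lebesgue measure. There exists $\delta_E\in(0,1)$ such that for every $\delta\in(\delta_E,1)$ the intrinsic length structure and the gradient structure of $(\mathbb R^2,\mathscr E_\delta,d_\delta,m)$ do not coincide; that is, there exists $u\in\mathbb D$ such that $$\frac{d}{dm}\Gamma_\delta(u,u)<(\mathrm{apLip}_{d_\delta}u)^2$$ on some set of positive $m$-measure.
   Context: The Cantor set $F$: remove from $[0,1]$ the middle open interval of length $1/10$, leaving two closed intervals $I_1,I_2$; for $n\ge2$, remove from each interval $I_{i_1\cdots i_{n-1}}$ the middle open interval of length $(1/10)^n$, leaving two closed intervals $I_{i_1\cdots i_{n-1}1}, I_{i_1\cdots i_{n-1}2}$; $F=\bigcap_{n}\bigcup_{i_1,\dots,i_n}I_{i_1\cdots i_n}$. For $\delta\in(0,1)$, $\mathscr E_\delta(u,u)=\int_{\mathbb R^2}(1-\delta 1_E)|\nabla u|^2\,dm$ with domain $\mathbb D=W^{1,2}(\mathbb R^2)$, where $\nabla$ is the distributional gradient. $\Gamma_\delta(u,u)=(1-\delta1_E)|\nabla u|^2\,m$ for $u\in\mathbb D_{\mathrm{loc}}=W^{1,2}_{\mathrm{loc}}(\mathbb R^2)$. The intrinsic distance is $d_\delta(x,y)=\sup\{u(x)-u(y):u\in\mathbb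 D_{\mathrm{loc}}\cap\mathscr C(\mathbb R^2),\ \frac{d}{dm}\Gamma_\delta(u,u)\le1\text{ a.e.}\}$. $\mathrm{apLip}_{d_\delta}u(x)=\inf_A\limsup_{y\in A,\,y\to x}\frac{|u(x)-u(y)|}{d_\delta(x,y)}$, the infimum taken over Borel sets $A$ having $x$ as a point of density. *)

theory Defs
  imports "HOL-Analysis.Analysis"
begin

text \<open>
  The plane is \<^typ>\<open>real \<times> real\<close>, whose library norm is the Euclidean one, and the reference
  measure \<open>m\<close> is \<^term>\<open>lebesgue\<close>, so that measurability means Lebesgue measurability. Elements of
  the Sobolev spaces are represented by functions; replacing a representative by one that agrees
  almost everywhere changes \<open>energy_measure\<close> not at all and \<open>ap_Lip\<close> only on a null set.
\<close>

subsection \<open>The Cantor set\<close>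

text \<open>The endpoints of the intervals left after \<open>n\<close> removals.\<close>

primrec cantor_intervals :: "nat \<Rightarrow> (real \<times> real) set" where
  "cantor_intervals 0 = {(0, 1)}"
| "cantor_intervals (Suc n) =
     (\<Union>(a, b)\<in>cantor_intervals n.
        {(a, (a + b) / 2 - (1 / 10) ^ Suc n / 2), ((a + b) / 2 + (1 / 10) ^ Suc n / 2, b)})"

definition cantor_F :: "real set" where
  "cantor_F = (\<Inter>n. \<Union>(a, b)\<in>cantor_intervals n. {a..b})"

definition cantor_E :: "(real \<times> real) set" where
  "cantor_E = cantor_F \<times> cantor_F"


subsection \<open>Distributional gradients and Sobolev spaces\<close>

primrec C_k :: "nat \<Rightarrow> ('a::euclidean_space \<Rightarrow> real) \<Rightarrow> bool" where
  "C_k 0 f \<longleftrightarrow> continuous_on UNIV f"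
| "C_k (Suc k) f \<longleftrightarrow>
     (\<forall>x. f differentiable (at x)) \<and> (\<forall>v. C_k k (\<lambda>x. frechet_derivative f (at x) v))"

definition test_function :: "('a::euclidean_space \<Rightarrow> real) \<Rightarrow> bool" where
  "test_function \<phi> \<longleftrightarrow> (\<forall>k. C_k k \<phi>) \<and> compact (closure {x. \<phi> x \<noteq> 0})"

definition locally_integrable :: "('a::euclidean_space \<Rightarrow> 'b::euclidean_space) \<Rightarrow> bool" where
  "locally_integrable f \<longleftrightarrow> (\<forall>K. compact K \<longrightarrow> f absolutely_integrable_on K)"

definition has_weak_gradient :: "('a::euclidean_space \<Rightarrow> real) \<Rightarrow> ('a \<Rightarrow> 'a) \<Rightarrow> bool" where
  "has_weak_gradient u g \<longleftrightarrow>
     locally_integrable u \<and> locally_integrable g \<and>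
     (\<forall>\<phi> v. test_function \<phi> \<longrightarrow>
        (LINT x|lebesgue. u x * frechet_derivative \<phi> (at x) v)
          = - (LINT x|lebesgue. (g x \<bullet> v) * \<phi> x))"

text \<open>The choice is immaterial: two weak gradients of \<open>u\<close> agree almost everywhere.\<close>

definition weak_gradient :: "('a::euclidean_space \<Rightarrow> real) \<Rightarrow> 'a \<Rightarrow> 'a" where
  "weak_gradient u = (SOME g. has_weak_gradient u g)"

definition L2 :: "('a::euclidean_space \<Rightarrow> 'b::euclidean_space) set" where
  "L2 = {f \<in> borel_measurable lebesgue. integrable lebesgue (\<lambda>x. (norm (f x))\<^sup>2)}"

definition L2_loc :: "('a::euclidean_space \<Rightarrow> 'b::euclidean_space) set" where
  "L2_loc = {f \<in> borel_measurable lebesgue.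
     \<forall>K. compact K \<longrightarrow> (\<lambda>x. (norm (f x))\<^sup>2) absolutely_integrable_on K}"

definition W12 :: "('a::euclidean_space \<Rightarrow> real) set" where
  "W12 = {u \<in> L2. \<exists>g\<in>L2. has_weak_gradient u g}"

definition W12_loc :: "('a::euclidean_space \<Rightarrow> real) set" where
  "W12_loc = {u \<in> L2_loc. \<exists>g\<in>L2_loc. has_weak_gradient u g}"


subsection \<open>Energy measure and intrinsic distance\<close>

text \<open>The Dirichlet form \<open>\<E>\<^sub>\<delta>(u, u)\<close> is the total mass of \<open>energy_measure \<delta> u\<close>.\<close>

definition energy_measure :: "real \<Rightarrow> (real \<times> real \<Rightarrow> real) \<Rightarrow> (real \<times> real) measure" where
  "energy_measure \<delta> u =
     density lebesgue
       (\<lambda>x. ennreal ((1 - \<delta> * indicator cantor_E x) * (norm (weak_gradient u x))\<^sup>2))"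

definition energy_density :: "real \<Rightarrow> (real \<times> real \<Rightarrow> real) \<Rightarrow> real \<times> real \<Rightarrow> ennreal" where
  "energy_density \<delta> u = RN_deriv lebesgue (energy_measure \<delta> u)"

definition intrinsic_dist :: "real \<Rightarrow> real \<times> real \<Rightarrow> real \<times> real \<Rightarrow> ereal" where
  "intrinsic_dist \<delta> x y =
     (SUP u \<in> {u \<in> W12_loc. continuous_on UNIV u \<and> (AE z in lebesgue. energy_density \<delta> u z \<le> 1)}.
        ereal (u x - u y))"


subsection \<open>Approximate pointwise Lipschitz constants\<close>

definition point_of_density :: "'a::euclidean_space set \<Rightarrow> 'a \<Rightarrow> bool" where
  "point_of_density A x \<longleftrightarrow>
     ((\<lambda>r. measure lebesgue (A \<inter> ball x r) / measure lebesgue (ball x r)) \<longlongrightarrow> 1) (at_right 0)"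

text \<open>The filter \<^term>\<open>at x within A\<close> does not require \<open>x \<in> A\<close> and ignores the value at \<open>y = x\<close>.\<close>

definition ap_Lip ::
    "('a::euclidean_space \<Rightarrow> 'a \<Rightarrow> ereal) \<Rightarrow> ('a \<Rightarrow> real) \<Rightarrow> 'a \<Rightarrow> ereal" where
  "ap_Lip d u x =
     (INF A \<in> {A \<in> sets borel. point_of_density A x}.
        Limsup (at x within A) (\<lambda>y. ereal \<bar>u x - u y\<bar> / d x y))"

end

(*
  The complement of F is dense, and a vertical line over a point outside F, or a horizontal line
  at such a height, avoids E = F x F. Along these lines every function admissible for the
  intrinsic distance is 1-Lipschitz, so by continuity it is 1-Lipschitz on the whole plane for the
  l1-norm: for every delta, the intrinsic distance is bounded by the l1-distance. For a cut-off
  u of the first coordinate, the approximate Lipschitz constant on E is therefore at least 1/2,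
  whereas the energy density on E is 1 - delta, and E has positive measure.
*)
theory Submission
  imports Defs
begin

subsection \<open>Functions of class \<open>C\<^sup>k\<close>\<close>

text \<open>The distance is defined through gradients known only almost everywhere, and a line is a
  null set, so nothing can be read off on a single line. But F is closed: a line over a point
  outside F lies in an open strip of parallel lines that all avoid E. The weak-gradient identity is
  integrated over a thin strip next to the line, and continuity of the function brings the bound
  back to the line. Avoiding E matters: there the condition
  \<open>(1 - \<delta>) * |g|^2 \<le> 1\<close> permits gradients up to
  \<open>1 / sqrt (1 - \<delta>)\<close>, which blow up as \<delta> tends to 1, while the bound
  along the strips is uniform in \<delta>.

  The infimum over sets A in \<open>ap_Lip\<close> may discard thin sets of directions, but a set
  with density point x still meets balls of comparable size placed next to x in the horizontal
  direction. There the l1-distance is at most twice the horizontal displacement, whence the 1/2.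

  The gradient is a choice and the energy density a Radon-Nikodym derivative. Both are determined
  only up to null sets, so any computation with them rests on almost everywhere uniqueness of weak
  gradients, hence on a sufficient supply of smooth test functions.\<close>

lemma frechet_derivative_eqI:
  assumes "(f has_derivative f') (at x)"
  shows "frechet_derivative f (at x) v = f' v"
  using frechet_derivative_at[OF assms] by simp

lemma C_k_SucD: "C_k (Suc k) f \<Longrightarrow> C_k k f"
proof (induction k arbitrary: f)
  case 0
  then show ?case
    by (auto intro!: continuous_at_imp_continuous_on differentiable_imp_continuous_within)
next
  case (Suc k)
  then show ?case by (metis C_k.simps(2))
qed

text \<open>Any explicitly known derivative may stand in for \<open>frechet_derivative\<close>, so
  the closure properties below follow by induction from the usual derivative rules.\<close>

lemma C_k_SucI:
  assumes "\<And>x. (f has_derivative f' x) (at x)" "\<And>v. C_k k (\<lambda>x. f' x v)"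
  shows "C_k (Suc k) f"
proof -
  have "frechet_derivative f (at x) v = f' x v" for x v
    by (rule frechet_derivative_eqI) (rule assms)
  then show ?thesis
    using assms by (auto simp: differentiable_def)
qed

lemma C_k_const [intro]: "C_k k (\<lambda>x. c)"
proof (induction k arbitrary: c)
  case (Suc k)
  show ?case by (rule C_k_SucI[where f' = "\<lambda>_ _. 0"]) (auto intro!: Suc derivative_eq_intros)
qed simp

lemma C_k_add:
  assumes "C_k k f" "C_k k g"
  shows "C_k k (\<lambda>x. f x + g x)"
  using assms
proof (induction k arbitrary: f g)
  case 0
  then show ?case by (auto intro: continuous_on_add)
next
  case (Suc k)
  show ?case
    using Suc.prems
    by (intro C_k_SucI[where f' = "\<lambda>x v. frechet_derivative f (at x) v + frechet_derivative g (at x) v"]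
        has_derivative_add Suc.IH) (auto simp: frechet_derivative_works)
qed

lemma C_k_mult:
  assumes "C_k k f" "C_k k g"
  shows "C_k k (\<lambda>x. f x * g x)"
  using assms
proof (induction k arbitrary: f g)
  case 0
  then show ?case by (auto intro: continuous_on_mult)
next
  case (Suc k)
  show ?case
    \<comment> \<open>The product rule leaves one factor undifferentiated; the induction hypothesis
      wants that factor at order \<open>k\<close>.\<close>
    using Suc.prems C_k_SucD[OF Suc.prems(1)] C_k_SucD[OF Suc.prems(2)]
    by (intro C_k_SucI[where f' = "\<lambda>x v. f x * frechet_derivative g (at x) v
          + frechet_derivative f (at x) v * g x"]
        has_derivative_mult Suc.IH C_k_add) (auto simp: frechet_derivative_works)
qed

lemma C_k_prod:
  assumes "\<And>i. i \<in> I \<Longrightarrow> C_k k (f i)"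
  shows "C_k k (\<lambda>x. \<Prod>i\<in>I. f i x)"
  using assms
  by (induction I rule: infinite_finite_induct) (auto intro!: C_k_mult C_k_const)

lemma C_k_affine:
  fixes f :: "'b::euclidean_space \<Rightarrow> real" and A :: "'a::euclidean_space \<Rightarrow> 'b"
  assumes "C_k k f" "bounded_linear A"
  shows "C_k k (\<lambda>x. f (A x + b))"
  using assms
proof (induction k arbitrary: f)
  case 0
  then show ?case
    using continuous_on_compose2[of UNIV f UNIV "\<lambda>x. A x + b"] linear_continuous_on[of A UNIV]
    by (simp add: continuous_on_add)
next
  case (Suc k)
  have f: "(f has_derivative frechet_derivative f (at (A x + b))) (at (A x + b))" for x
    using Suc.prems by (auto simp: frechet_derivative_works)
  have "((\<lambda>x. A x + b) has_derivative A) (at x)" for x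
    using has_derivative_add[OF bounded_linear_imp_has_derivative[OF Suc.prems(2)] has_derivative_const]
    by simp
  from has_derivative_compose[OF this f]
  show ?case
    using Suc.prems
    by (intro C_k_SucI[where f' = "\<lambda>x v. frechet_derivative f (at (A x + b)) (A v)"])
      (auto intro!: Suc.IH[of "\<lambda>y. frechet_derivative f (at y) _"])
qed

lemma C_k_real_derivative:
  fixes f :: "real \<Rightarrow> real"
  assumes "\<And>x. (f has_real_derivative f' x) (at x)" "C_k k f'"
  shows "C_k (Suc k) f"
  using assms
  by (intro C_k_SucI[where f' = "\<lambda>x v. f' x * v"] C_k_mult C_k_const)
    (auto simp: has_field_derivative_def)


subsection \<open>Smooth cut-off functions\<close>

text \<open>The factor \<open>poly p (1 / t)\<close> makes this class of functions closed under differentiation.\<close>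

definition flat :: "real poly \<Rightarrow> real \<Rightarrow> real" where
  "flat p t = (if t \<le> 0 then 0 else poly p (1 / t) * exp (- 1 / t))"

lemma poly_times_exp_minus_tendsto_0: "((\<lambda>s. poly p s * exp (- s)) \<longlongrightarrow> (0::real)) at_top"
proof -
  have *: "poly p s * exp (- s) = (\<Sum>i\<le>degree p. coeff p i * (s ^ i / exp s))" for s
    by (simp add: poly_altdef exp_minus sum_distrib_right divide_inverse mult.assoc)
  have "((\<lambda>s. \<Sum>i\<le>degree p. coeff p i * (s ^ i / exp s)) \<longlongrightarrow> (\<Sum>i\<le>degree p. coeff p i * 0)) at_top"
    by (intro tendsto_intros tendsto_power_div_exp_0)
  then show ?thesis by (simp add: *)
qed

lemma flat_tendsto_0: "(flat p \<longlongrightarrow> 0) (at 0)"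
proof -
  have "((\<lambda>t. poly p (1 / t) * exp (- 1 / t)) \<longlongrightarrow> 0) (at_right 0)"
    using filterlim_compose[OF poly_times_exp_minus_tendsto_0 filterlim_inverse_at_top_right]
    by (simp add: inverse_eq_divide)
  then have "(flat p \<longlongrightarrow> 0) (at_right 0)"
    by (rule Lim_transform_eventually) (auto simp: flat_def eventually_at_filter)
  moreover have "(flat p \<longlongrightarrow> 0) (at_left 0)"
    by (rule tendsto_eventually) (auto simp: flat_def eventually_at_filter)
  ultimately show ?thesis by (simp add: filterlim_split_at)
qed

text \<open>With s = 1 / t, the derivative of p(s) exp(-s) in t is s^2 (p(s) - p'(s)) exp(-s); the
  polynomial in the statement is this prefactor.\<close>

lemma flat_has_derivative:
  "(flat p has_real_derivative flat ([:0, 0, 1:] * (p - pderiv p)) t) (at t)"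
proof -
  let ?q = "[:0, 0, 1:] * (p - pderiv p)"
  consider "t < 0" | "t = 0" | "t > 0" by linarith
  then show ?thesis
  proof cases
    case 1
    have "((\<lambda>_. 0) has_real_derivative flat ?q t) (at t)"
      using 1 by (simp add: flat_def)
    then show ?thesis
      by (rule has_field_derivative_transform_within_open[where S = "{..<0}"])
        (use 1 in \<open>auto simp: flat_def\<close>)
  next
    case 2
    \<comment> \<open>Dividing by h multiplies p(1/h) by 1/h, so the difference quotient at 0 is
      again a function of this class and tends to 0.\<close>
    have "(\<lambda>h. (flat p (0 + h) - flat p 0) / h) = flat (pCons 0 p)"
      by (auto simp: flat_def fun_eq_iff)
    then show ?thesis
      using flat_tendsto_0[of "pCons 0 p"] 2 by (simp add: DERIV_def flat_def)
  next
    case 3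
    have "((\<lambda>t. poly p (1 / t) * exp (- 1 / t)) has_real_derivative flat ?q t) (at t)"
      using 3 by (auto intro!: derivative_eq_intros DERIV_chain2[OF poly_DERIV]
          simp: flat_def field_simps power2_eq_square)
    then show ?thesis
      by (rule has_field_derivative_transform_within_open[where S = "{0<..}"])
        (use 3 in \<open>auto simp: flat_def\<close>)
  qed
qed

lemma C_k_flat: "C_k k (flat p)"
proof (induction k arbitrary: p)
  case 0
  show ?case
    using DERIV_isCont[OF flat_has_derivative] by (simp add: continuous_at_imp_continuous_on)
next
  case (Suc k)
  show ?case by (rule C_k_real_derivative[OF flat_has_derivative Suc])
qed

text \<open>The step is the normalised antiderivative of a bump supported in [0, 1]. Its derivative
  is exported as well, because rescaled copies of it later serve as approximate point
  masses.\<close>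

lemma smooth_step_exists:
  obtains h h' :: "real \<Rightarrow> real" where "\<And>k. C_k k h"
    "\<And>t. (h has_real_derivative h' t) (at t)" "\<And>t. 0 \<le> h' t" "continuous_on UNIV h'"
    "\<And>t. 0 \<le> h t" "\<And>t. h t \<le> 1"
    "\<And>t. t \<le> 0 \<Longrightarrow> h t = 0" "\<And>t. t \<ge> 1 \<Longrightarrow> h t = 1"
proof -
  define b where "b = (\<lambda>t. flat 1 t * flat 1 (- t + 1))"
  have Cb: "C_k k b" for k
    unfolding b_def using C_k_affine[OF C_k_flat, of "uminus" k 1 1]
    by (intro C_k_mult C_k_flat) (simp add: bounded_linear_minus)
  have b0: "b t = 0" if "t \<le> 0 \<or> t \<ge> 1" for t
    using that by (auto simp: b_def flat_def)
  have b_nonneg: "0 \<le> b t" for t by (simp add: b_def flat_def)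
  have b_pos: "0 < b t" if "0 < t" "t < 1" for t
    using that by (simp add: b_def flat_def)
  have "isCont b x" for x
    using Cb[of 0] by (simp add: continuous_on_eq_continuous_at)
  then obtain B where B: "\<And>t. (B has_real_derivative b t) (at t)"
    using einterval_antiderivative[of "-\<infinity>" "\<infinity>" b]
    by (auto simp: has_real_derivative_iff_has_vector_derivative)
  have const: "B s = B t" if "\<And>x. s \<le> x \<Longrightarrow> x \<le> t \<Longrightarrow> b x = 0" "s \<le> t" for s t
  proof (cases "s = t")
    case False
    with that have "s < t" by simp
    then obtain z where "s < z" "z < t" "B t - B s = (t - s) * b z"
      using MVT2[of s t B b] B by auto
    then show ?thesis using that(1)[of z] by simp
  qed simp
  define c where "c = B 1 - B 0"
  have "c > 0"
  proof -
    obtain z where "0 < z" "z < 1" "B 1 - B 0 = (1 - 0) * b z"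
      using MVT2[of 0 1 B b] B by auto
    then show ?thesis using b_pos[of z] by (simp add: c_def)
  qed
  define h where "h = (\<lambda>t. (B t - B 0) / c)"
  have h: "(h has_real_derivative b t / c) (at t)" for t
    using \<open>c > 0\<close> unfolding h_def by (auto intro!: derivative_eq_intros B)
  show ?thesis
  proof (rule that[OF _ h])
    show "C_k k h" for k
    proof (rule C_k_SucD, rule C_k_real_derivative[OF h])
      show "C_k k (\<lambda>x. b x / c)"
        using C_k_mult[OF Cb C_k_const, of k "1 / c"] by simp
    qed
    show "continuous_on UNIV (\<lambda>t. b t / c)"
      using Cb[of 0] \<open>c > 0\<close> by (intro continuous_intros) auto
    have "(B 1 - B 0) / c = 1" using \<open>c > 0\<close> unfolding c_def[symmetric] by simp
    then show h1: "h t = 1" if "t \<ge> 1" for t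
      using const[of 1 t] b0 that by (simp add: h_def)
    show h'_nonneg: "0 \<le> b t / c" for t using b_nonneg \<open>c > 0\<close> by simp
    show h0: "h t = 0" if "t \<le> 0" for t
      using const[of t 0] b0 that by (simp add: h_def)
    have "mono h"
      using h h'_nonneg by (intro monoI) (metis DERIV_nonneg_imp_nondecreasing)
    then show "0 \<le> h t" "h t \<le> 1" for t
      using h0[of "min t 0"] h1[of "max t 1"] monoD[of h "min t 0" t] monoD[of h t "max t 1"]
      by simp_all
  qed
qed

lemma test_functionI:
  assumes "\<And>k. C_k k f" "compact K" "\<And>x. x \<notin> K \<Longrightarrow> f x = 0"
  shows "test_function f"
proof -
  have "{x. f x \<noteq> 0} \<subseteq> K"
    using assms(3) by blast
  then show ?thesis
    using assms(1) bounded_subset[OF compact_imp_bounded[OF assms(2)]]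
    by (simp add: test_function_def compact_closure)
qed

lemma test_function_continuous: "test_function \<phi> \<Longrightarrow> continuous_on S \<phi>"
  using C_k.simps(1) by (metis continuous_on_subset subset_UNIV test_function_def)

lemma test_functionE:
  assumes "test_function \<phi>"
  obtains r where "0 < r" "\<And>x. norm x \<ge> r \<Longrightarrow> \<phi> x = 0"
proof -
  have "bounded {x. \<phi> x \<noteq> 0}"
    using assms by (simp add: test_function_def compact_closure)
  then obtain r where "\<And>x. \<phi> x \<noteq> 0 \<Longrightarrow> norm x \<le> r"
    by (auto simp: bounded_iff)
  then have "\<phi> x = 0" if "norm x \<ge> max 0 r + 1" for x
    using that by (smt (verit))
  then show ?thesis by (intro that[of "max 0 r + 1"]) auto
qed

text \<open>In each coordinate a ramp of width 1 / n rises and falls inside the box. The functions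
  therefore vanish off the open box, stay below its indicator, and reach 1 at every interior point
  once n is large.\<close>

lemma test_functions_tendsto_indicator_box:
  fixes l u :: "'a::euclidean_space"
  obtains \<phi> where "\<And>n. test_function (\<phi> n)" "\<And>n x. \<bar>\<phi> n x\<bar> \<le> indicator (box l u) x"
    "\<And>x. (\<lambda>n. \<phi> n x) \<longlonglongrightarrow> indicator (box l u) x"
proof -
  obtain h h' :: "real \<Rightarrow> real" where h: "\<And>k. C_k k h" "\<And>t. 0 \<le> h t" "\<And>t. h t \<le> 1"
    "\<And>t. t \<le> 0 \<Longrightarrow> h t = 0" "\<And>t. t \<ge> 1 \<Longrightarrow> h t = 1"
    using smooth_step_exists by (smt (verit))
  \<comment> \<open>The arguments of \<open>h\<close> are n times the distances to the lower and
    upper faces, spelled as a linear map plus a constant to fit \<open>C_k_affine\<close>.\<close>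
  define f where "f = (\<lambda>n b x. h (real n * (b \<bullet> x) + - real n * (l \<bullet> b)) * h (- real n * (b \<bullet> x) + real n * (u \<bullet> b)))"
  define \<phi> where "\<phi> = (\<lambda>n x. \<Prod>b\<in>Basis. f n b x)"
  have Cf: "C_k k (f n b)" for k n b
    unfolding f_def
    by (intro C_k_mult C_k_affine[OF h(1), of "\<lambda>x. _ * (b \<bullet> x)"]
        bounded_linear_mult_right[THEN bounded_linear_compose] bounded_linear_inner_right)
  have f01: "0 \<le> f n b x" "f n b x \<le> 1" for n b x
    using h by (auto simp: f_def intro: mult_le_one)
  have outside: "\<phi> n x = 0" if "x \<notin> box l u" for n x
  proof -
    have "\<not> (\<forall>b\<in>Basis. l \<bullet> b < x \<bullet> b \<and> x \<bullet> b < u \<bullet> b)"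
      using that by (simp only: mem_box not_False_eq_True)
    then obtain b where b: "b \<in> Basis" "x \<bullet> b \<le> l \<bullet> b \<or> u \<bullet> b \<le> x \<bullet> b"
      unfolding not_less[symmetric] by blast
    from b(2) have "f n b x = 0"
    proof
      assume "x \<bullet> b \<le> l \<bullet> b"
      then have "real n * (b \<bullet> x) + - real n * (l \<bullet> b) \<le> 0"
        using mult_left_mono[of "x \<bullet> b" "l \<bullet> b" "real n"] by (simp add: inner_commute)
      then show ?thesis by (simp add: f_def h(4))
    next
      assume "u \<bullet> b \<le> x \<bullet> b"
      then have "- real n * (b \<bullet> x) + real n * (u \<bullet> b) \<le> 0"
        using mult_left_mono[of "u \<bullet> b" "x \<bullet> b" "real n"] by (simp add: inner_commute)
      then show ?thesis by (simp add: f_def h(4))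
    qed
    with b(1) show ?thesis by (auto simp: \<phi>_def)
  qed
  show ?thesis
  proof (rule that[of \<phi>])
    show "test_function (\<phi> n)" for n
      unfolding \<phi>_def
      using outside box_subset_cbox[of l u]
      by (intro test_functionI[of _ "cbox l u"] C_k_prod Cf) (auto simp: \<phi>_def)
    show "\<bar>\<phi> n x\<bar> \<le> indicator (box l u) x" for n x
    proof (cases "x \<in> box l u")
      case True
      then show ?thesis
        using f01 prod_le_1[of Basis "\<lambda>b. f n b x"] by (auto simp: \<phi>_def abs_prod)
    qed (simp add: outside)
    show "(\<lambda>n. \<phi> n x) \<longlonglongrightarrow> indicator (box l u) x" for x
    proof (cases "x \<in> box l u")
      case True
      have ev: "\<forall>\<^sub>F n in sequentially. 1 \<le> real n * c" if "c > 0" for c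
        using eventually_ge_at_top[of "nat \<lceil>1 / c\<rceil>"]
        by eventually_elim (use that in \<open>simp add: nat_ceiling_le_eq field_simps\<close>)
      have "(\<lambda>n. f n b x) \<longlonglongrightarrow> 1" if "b \<in> Basis" for b
      proof (rule tendsto_eventually)
        have "0 < x \<bullet> b - l \<bullet> b" "0 < u \<bullet> b - x \<bullet> b"
          using True that by (auto simp: mem_box)
        from this[THEN ev] show "\<forall>\<^sub>F n in sequentially. f n b x = 1"
          by eventually_elim (simp add: f_def h(5) inner_commute right_diff_distrib)
      qed
      from tendsto_prod[OF this] show ?thesis
        using True by (simp add: \<phi>_def)
    qed (simp add: outside)
  qed
qed


subsection \<open>Weak gradients\<close>

lemma continuous_compact_support_integrable:
  fixes f :: "'a::euclidean_space \<Rightarrow> real"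
  assumes "continuous_on UNIV f" "\<And>x. norm x \<ge> r \<Longrightarrow> f x = 0"
  shows "integrable lborel f"
proof -
  have "integrable lborel (\<lambda>x. indicator (cball 0 r) x *\<^sub>R f x)"
    using assms by (intro borel_integrable_compact) (auto intro: continuous_on_subset)
  also have "(\<lambda>x. indicator (cball 0 r) x *\<^sub>R f x) = f"
  proof
    fix x show "indicator (cball 0 r) x *\<^sub>R f x = f x"
      using assms(2)[of x] by (cases "norm x \<le> r") auto
  qed
  finally show ?thesis .
qed

lemma continuous_locally_integrable:
  fixes f :: "'a::euclidean_space \<Rightarrow> 'b::euclidean_space"
  assumes "continuous_on UNIV f"
  shows "locally_integrable f"
  unfolding locally_integrable_def set_integrable_def
proof (intro allI impI)
  fix K :: "'a set" assume "compact K"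
  then have "integrable lborel (\<lambda>x. indicator K x *\<^sub>R f x)"
    using assms by (intro borel_integrable_compact) (auto intro: continuous_on_subset)
  then show "integrable lebesgue (\<lambda>x. indicator K x *\<^sub>R f x)"
    by (simp add: integrable_completion borel_measurable_integrable)
qed

lemma locally_integrable_measurable:
  fixes f :: "'a::euclidean_space \<Rightarrow> 'b::euclidean_space"
  assumes "locally_integrable f"
  shows "f \<in> borel_measurable lebesgue"
proof (rule borel_measurable_LIMSEQ_metric)
  show "(\<lambda>x. indicator (cball 0 (real n)) x *\<^sub>R f x) \<in> borel_measurable lebesgue" for n
    using assms compact_cball borel_measurable_integrable
    unfolding locally_integrable_def set_integrable_def by blast
  show "(\<lambda>n. indicator (cball 0 (real n)) x *\<^sub>R f x) \<longlonglongrightarrow> f x" for x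
  proof (rule tendsto_eventually)
    show "\<forall>\<^sub>F n in sequentially. indicator (cball 0 (real n)) x *\<^sub>R f x = f x"
      using eventually_ge_at_top[of "nat \<lceil>norm x\<rceil>"]
      by eventually_elim (simp add: indicator_def nat_ceiling_le_eq)
  qed
qed

lemma locally_integrable_mult_integrable:
  fixes h :: "'a::euclidean_space \<Rightarrow> real"
  assumes "locally_integrable h" "\<phi> \<in> borel_measurable lebesgue" "compact K"
    "\<And>x. \<bar>\<phi> x\<bar> \<le> M * indicator K x"
  shows "integrable lebesgue (\<lambda>x. h x * \<phi> x)"
proof (rule Bochner_Integration.integrable_bound)
  show "integrable lebesgue (\<lambda>x. M * (indicator K x *\<^sub>R h x))"
    using assms(1,3) unfolding locally_integrable_def set_integrable_def
    by (intro integrable_mult_right) blast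
  show "(\<lambda>x. h x * \<phi> x) \<in> borel_measurable lebesgue"
    using locally_integrable_measurable[OF assms(1)] assms(2) by (rule borel_measurable_times)
  show "AE x in lebesgue. norm (h x * \<phi> x) \<le> norm (M * (indicator K x *\<^sub>R h x))"
  proof (rule AE_I2)
    fix x
    have "\<bar>\<phi> x\<bar> \<le> \<bar>M * indicator K x\<bar>"
      using assms(4)[of x] by linarith
    then show "norm (h x * \<phi> x) \<le> norm (M * (indicator K x *\<^sub>R h x))"
      using mult_left_mono[of "\<bar>\<phi> x\<bar>" "\<bar>M * indicator K x\<bar>" "\<bar>h x\<bar>"]
      by (simp add: abs_mult mult.commute mult.left_commute)
  qed
qed

lemma locally_integrable_mult_test_function:
  fixes h :: "'a::euclidean_space \<Rightarrow> real"
  assumes "locally_integrable h" "test_function \<phi>"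
  shows "integrable lebesgue (\<lambda>x. h x * \<phi> x)"
proof -
  obtain r where r: "\<And>x. norm x \<ge> r \<Longrightarrow> \<phi> x = 0"
    using test_functionE[OF assms(2)] by blast
  have "bounded (\<phi> ` cball 0 r)"
    using assms(2) by (intro compact_imp_bounded compact_continuous_image test_function_continuous) auto
  then obtain M where M: "\<And>x. norm x \<le> r \<Longrightarrow> \<bar>\<phi> x\<bar> \<le> M"
    unfolding bounded_iff by force
  show ?thesis
  proof (rule locally_integrable_mult_integrable[OF assms(1)])
    show "\<phi> \<in> borel_measurable lebesgue"
      using test_function_continuous[OF assms(2)]
      by (intro measurable_completion) (auto intro: borel_measurable_continuous_onI)
    show "\<bar>\<phi> x\<bar> \<le> M * indicator (cball 0 r) x" for x
      using M[of x] r[of x] by (cases "norm x \<le> r") auto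
  qed simp
qed

text \<open>Open boxes form an intersection-stable generator of the Borel sets, so vanishing
  integrals extend from boxes to all Borel sets, and a density with vanishing integrals is
  null.\<close>

lemma AE_zero_if_box_integrals_zero:
  fixes h :: "'a::euclidean_space \<Rightarrow> real"
  assumes h: "integrable lborel h"
    and box: "\<And>l u. (LINT x|lborel. indicator (box l u) x * h x) = 0"
  shows "AE x in lborel. h x = 0"
proof (rule density_unique_real[OF h integrable_zero])
  fix A :: "'a set" assume "A \<in> sets lborel"
  then have "A \<in> sigma_sets UNIV (range (\<lambda>(a, b). box a b :: 'a set))"
    by (simp add: borel_eq_box)
  moreover have int: "integrable lborel (\<lambda>x. indicator A x * h x)" if "A \<in> sets borel" for A
    using integrable_mult_indicator[of A lborel h] h that by simp
  moreover have sets: "sigma_sets UNIV (range (\<lambda>(a, b). box a b :: 'a set)) = sets borel"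
    by (simp add: borel_eq_box)
  \<comment> \<open>The complement step of the induction needs the integral over the whole space,
    obtained by exhausting it with growing boxes.\<close>
  have total: "(LINT x|lborel. h x) = 0"
  proof (rule LIMSEQ_unique)
    let ?B = "\<lambda>n. box (- real n *\<^sub>R One) (real n *\<^sub>R One) :: 'a set"
    show "(\<lambda>n. LINT x|lborel. indicator (?B n) x * h x) \<longlonglongrightarrow> (LINT x|lborel. h x)"
    proof (rule integral_dominated_convergence)
      show "integrable lborel (\<lambda>x. norm (h x))" using h by simp
      show "AE x in lborel. (\<lambda>n. indicator (?B n) x * h x) \<longlonglongrightarrow> h x"
      proof (rule AE_I2, rule tendsto_eventually)
        fix x :: 'a
        obtain N :: nat where N: "norm x < real N" using reals_Archimedean2 by blast
        have "x \<in> ?B n" if "n \<ge> N" for n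
          unfolding mem_box
        proof
          fix b :: 'a assume b: "b \<in> Basis"
          have "norm x < real n" using N that by linarith
          with Basis_le_norm[OF b, of x]
          show "(- real n *\<^sub>R One) \<bullet> b < x \<bullet> b \<and> x \<bullet> b < (real n *\<^sub>R One) \<bullet> b"
            using b by auto
        qed
        then show "\<forall>\<^sub>F n in sequentially. indicator (?B n) x * h x = h x"
          unfolding eventually_sequentially by (auto intro!: exI[of _ N])
      qed
      show "AE x in lborel. norm (indicator (?B n) x * h x) \<le> norm (h x)" for n
        by (auto simp: indicator_def)
    qed (use h int in \<open>auto intro: borel_measurable_integrable\<close>)
    show "(\<lambda>n. LINT x|lborel. indicator (?B n) x * h x) \<longlonglongrightarrow> 0"
      by (simp add: box)
  qed
  have "(LINT x|lborel. indicator A x * h x) = 0"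
  proof (rule sigma_sets_induct_disjoint[OF _ _ calculation(1)])
    show "Int_stable (range (\<lambda>(a, b). box a b :: 'a set))"
      by (auto simp: Int_stable_def box_Int_box)
    show "(LINT x|lborel. indicator B x * h x) = 0"
      if "B \<in> range (\<lambda>(a, b). box a b :: 'a set)" for B
      using that box by auto
    show "(LINT x|lborel. indicator (UNIV - B) x * h x) = 0"
      if "B \<in> sigma_sets UNIV (range (\<lambda>(a, b). box a b :: 'a set))"
        "(LINT x|lborel. indicator B x * h x) = 0" for B
    proof -
      have "(\<lambda>x. indicator (UNIV - B) x * h x) = (\<lambda>x. h x - indicator B x * h x)"
        by (auto simp: indicator_def)
      then show ?thesis using that total h int[of B] sets by simp
    qed
    show "(LINT x|lborel. indicator (\<Union>i. B i) x * h x) = 0"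
      if "disjoint_family B" "range B \<subseteq> sigma_sets UNIV (range (\<lambda>(a, b). box a b :: 'a set))"
        "\<And>i. (LINT x|lborel. indicator (B i) x * h x) = 0" for B :: "nat \<Rightarrow> 'a set"
    proof -
      have B: "B i \<in> sets borel" for i using that(2) sets by blast
      have "(LINT x:(\<Union>i. B i)|lborel. h x) = (\<Sum>i. LINT x:B i|lborel. h x)"
        using that(1) B int[of "\<Union>i. B i"]
        by (intro lebesgue_integral_countable_add)
          (auto simp: disjoint_family_on_def set_integrable_def)
      then show ?thesis using that(3) by (simp add: set_lebesgue_integral_def)
    qed
  qed simp_all
  then show "(LINT x:A|lborel. h x) = (LINT x:A|lborel. 0)"
    by (simp add: set_lebesgue_integral_def)
qed

text \<open>The fundamental lemma of the calculus of variations. Smooth approximations of box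
  indicators, dominated by the indicator itself, turn the hypothesis into vanishing box
  integrals.\<close>

lemma AE_zero_if_test_integrals_zero:
  fixes h :: "'a::euclidean_space \<Rightarrow> real"
  assumes h: "locally_integrable h"
    and test: "\<And>\<phi>. test_function \<phi> \<Longrightarrow> (LINT x|lebesgue. h x * \<phi> x) = 0"
  shows "AE x in lebesgue. h x = 0"
proof -
  have box_int: "integrable lebesgue (\<lambda>x. h x * indicator (box l u) x)" for l u
    by (rule locally_integrable_mult_integrable[OF h, of _ "cbox l u" 1])
      (auto simp: indicator_def box_subset_cbox[THEN subsetD] simp del: indicator_simps
        intro!: borel_measurable_indicator[unfolded indicator_def])
  have box: "(LINT x|lebesgue. h x * indicator (box l u) x) = 0" for l u
  proof -
    obtain \<phi> where \<phi>: "\<And>n. test_function (\<phi> n)" "\<And>n x. \<bar>\<phi> n x\<bar> \<le> indicator (box l u) x"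
      "\<And>x. (\<lambda>n. \<phi> n x) \<longlonglongrightarrow> indicator (box l u) x"
      using test_functions_tendsto_indicator_box[of l u] by blast
    have "(\<lambda>n. LINT x|lebesgue. h x * \<phi> n x) \<longlonglongrightarrow> (LINT x|lebesgue. h x * indicator (box l u) x)"
    proof (rule integral_dominated_convergence)
      show "integrable lebesgue (\<lambda>x. \<bar>h x * indicator (box l u) x\<bar>)"
        using box_int by simp
      show "AE x in lebesgue. (\<lambda>n. h x * \<phi> n x) \<longlonglongrightarrow> h x * indicator (box l u) x"
        by (intro AE_I2 tendsto_intros \<phi>)
      show "AE x in lebesgue. norm (h x * \<phi> n x) \<le> \<bar>h x * indicator (box l u) x\<bar>" for n
        using \<phi>(2)[of n] by (auto simp: abs_mult intro!: mult_left_mono)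
    qed (use box_int locally_integrable_mult_test_function[OF h \<phi>(1)] in
        \<open>auto intro: borel_measurable_integrable\<close>)
    then show ?thesis using test[OF \<phi>(1)] by (simp add: LIMSEQ_const_iff)
  qed
  have "AE x in lebesgue. h x * indicator (box (- (real n *\<^sub>R One)) (real n *\<^sub>R One)) x = 0" for n
  proof -
    let ?B = "box (- (real n *\<^sub>R One)) (real n *\<^sub>R One) :: 'a set"
    \<comment> \<open>The box criterion concerns Borel functions integrable on the whole space:
      \<open>h\<close> is cut off to a large box and replaced by a Borel representative.\<close>
    obtain k where k: "k \<in> borel_measurable lborel" "AE x in lborel. h x * indicator ?B x = k x"
      using completion_ex_borel_measurable_real[OF borel_measurable_integrable[OF box_int]] by blast
    have k_lebesgue: "k \<in> borel_measurable lebesgue"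
      using k(1) by (rule measurable_completion)
    have AE: "AE x in lebesgue. h x * indicator ?B x = k x"
      using k(2) by (rule AE_completion)
    have "AE x in lborel. k x = 0"
    proof (rule AE_zero_if_box_integrals_zero)
      have "integrable lebesgue k"
        using integrable_cong_AE_imp[OF box_int k_lebesgue] AE by (simp add: eq_commute)
      then show "integrable lborel k"
        using k(1) by (simp add: integrable_completion)
      fix l u :: 'a
      have "(LINT x|lborel. indicator (box l u) x * k x) = (LINT x|lebesgue. indicator (box l u) x * k x)"
        using k(1) by (intro integral_completion[symmetric]) simp
      also have "\<dots> = (LINT x|lebesgue. h x * indicator (?B \<inter> box l u) x)"
      proof (rule integral_cong_AE)
        show "AE x in lebesgue. indicator (box l u) x * k x = h x * indicator (?B \<inter> box l u) x"
          using AE by eventually_elim (auto simp: indicator_def)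
      qed (use k_lebesgue locally_integrable_measurable[OF h] in
          \<open>auto intro!: borel_measurable_times borel_measurable_indicator\<close>)
      also have "\<dots> = 0" by (simp add: box Int_interval box_Int_box)
      finally show "(LINT x|lborel. indicator (box l u) x * k x) = 0" .
    qed
    then have "AE x in lebesgue. k x = 0" by (rule AE_completion)
    with AE show ?thesis by eventually_elim simp
  qed
  then have "AE x in lebesgue. \<forall>n. h x * indicator (box (- (real n *\<^sub>R One)) (real n *\<^sub>R One)) x = 0"
    unfolding AE_all_countable by blast
  then show ?thesis
  proof eventually_elim
    fix x assume *: "\<forall>n. h x * indicator (box (- (real n *\<^sub>R One)) (real n *\<^sub>R One)) x = 0"
    obtain n where "x \<in> box (- (real n *\<^sub>R One)) (real n *\<^sub>R One)"
      using UNIV_I[of x, folded UN_box_eq_UNIV] by blast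
    with * show "h x = 0" by (metis indicator_simps(1) mult.right_neutral)
  qed
qed

text \<open>Each coordinate of the difference integrates to 0 against every test function. This
  frees the energy density from the arbitrary choice inside \<open>weak_gradient\<close>.\<close>

lemma has_weak_gradient_AE_unique:
  fixes u :: "'a::euclidean_space \<Rightarrow> real"
  assumes g: "has_weak_gradient u g" and g': "has_weak_gradient u g'"
  shows "AE x in lebesgue. g x = g' x"
proof -
  have "AE x in lebesgue. (g x - g' x) \<bullet> b = 0" if "b \<in> Basis" for b
  proof (rule AE_zero_if_test_integrals_zero)
    have comp: "locally_integrable (\<lambda>x. f x \<bullet> b)" if "locally_integrable f" for f :: "'a \<Rightarrow> 'a"
      using that \<open>b \<in> Basis\<close> by (auto simp: locally_integrable_def intro: absolutely_integrable_component)
    note loc = comp[of g] comp[of g']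
    show "locally_integrable (\<lambda>x. (g x - g' x) \<bullet> b)"
      using loc g g' by (auto simp: locally_integrable_def has_weak_gradient_def inner_diff_left
          intro!: set_integral_diff)
    fix \<phi> :: "'a \<Rightarrow> real" assume \<phi>: "test_function \<phi>"
    have "(LINT x|lebesgue. (g x - g' x) \<bullet> b * \<phi> x)
        = (LINT x|lebesgue. (g x \<bullet> b) * \<phi> x - (g' x \<bullet> b) * \<phi> x)"
      by (simp add: inner_diff_left left_diff_distrib)
    also have "\<dots> = (LINT x|lebesgue. (g x \<bullet> b) * \<phi> x) - (LINT x|lebesgue. (g' x \<bullet> b) * \<phi> x)"
      using loc g g' \<phi>
      by (intro Bochner_Integration.integral_diff locally_integrable_mult_test_function)
        (auto simp: has_weak_gradient_def)
    also have "\<dots> = 0"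
      using g g' \<phi> unfolding has_weak_gradient_def by (metis add.inverse_inverse diff_self)
    finally show "(LINT x|lebesgue. (g x - g' x) \<bullet> b * \<phi> x) = 0" .
  qed
  then have "AE x in lebesgue. \<forall>b\<in>Basis. (g x - g' x) \<bullet> b = 0"
    by (simp add: AE_ball_countable countable_finite)
  then show ?thesis
    by eventually_elim (auto intro: euclidean_eqI simp: inner_diff_left)
qed

section \<open>Integration by parts: test functions as Sobolev functions\<close>

lemma frechet_derivative_along_line:
  fixes w :: "'a::euclidean_space \<Rightarrow> real"
  assumes "w differentiable (at (x + t *\<^sub>R v))"
  shows "((\<lambda>t. w (x + t *\<^sub>R v)) has_real_derivative frechet_derivative w (at (x + t *\<^sub>R v)) v) (at t)"
proof -
  have d: "(w has_derivative frechet_derivative w (at (x + t *\<^sub>R v))) (at (x + t *\<^sub>R v))"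
    using assms by (simp add: frechet_derivative_works)
  have "((\<lambda>t. x + t *\<^sub>R v) has_derivative (\<lambda>h. h *\<^sub>R v)) (at t)"
    by (auto intro!: derivative_eq_intros)
  from has_derivative_compose[OF this d] show ?thesis
    using linear_scale[OF has_derivative_linear[OF d]]
    by (simp add: has_field_derivative_def mult.commute[of _ "frechet_derivative w _ _"])
qed

text \<open>By translation invariance every difference quotient of \<open>w\<close> in direction
  \<open>v\<close> has integral 0; dominated convergence passes this to the derivative.\<close>

lemma integral_frechet_derivative_eq_0:
  fixes w :: "'a::euclidean_space \<Rightarrow> real"
  assumes w: "C_k (Suc 0) w" and support: "\<And>x. norm x \<ge> r \<Longrightarrow> w x = 0"
  shows "(LINT x|lborel. frechet_derivative w (at x) v) = 0"
proof -
  define D where "D x = frechet_derivative w (at x) v" for x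
  have deriv: "((\<lambda>t. w (x + t *\<^sub>R v)) has_real_derivative D (x + t *\<^sub>R v)) (at t)" for x t
    using w frechet_derivative_along_line[of w x t v] by (simp add: D_def)
  have cont_D: "continuous_on S D" for S
    using w by (auto simp: D_def[abs_def] intro: continuous_on_subset)
  have cont_w: "continuous_on UNIV w"
    using C_k_SucD[OF w] by simp
  \<comment> \<open>Quotients with step at most 1 vanish for \<open>norm x > r + norm v\<close>.
    Elsewhere the mean value theorem evaluates \<open>D\<close> at a point moved by at most another
    \<open>norm v\<close>, hence the factor 2.\<close>
  have "bounded (D ` cball 0 (r + 2 * norm v))"
    by (intro compact_imp_bounded compact_continuous_image cont_D) simp
  then obtain M where M: "\<bar>D x\<bar> \<le> M" if "norm x \<le> r + 2 * norm v" for x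
    unfolding bounded_iff by force
  define s where "s n = inverse (real (Suc n))" for n
  have s: "0 < s n" "s n \<le> 1" for n
    by (auto simp: s_def inverse_le_1_iff)
  have s_lim: "filterlim s (at 0) sequentially"
    using s(1) LIMSEQ_inverse_real_of_nat
    unfolding s_def[symmetric] by (intro filterlim_atI) (auto simp: less_imp_neq[symmetric])
  define q where "q n x = (w (x + s n *\<^sub>R v) - w x) / s n" for n x
  have shift_int: "integrable lborel (\<lambda>x. w (c + x))" for c
  proof (rule continuous_compact_support_integrable)
    show "continuous_on UNIV (\<lambda>x. w (c + x))"
      by (intro continuous_on_compose2[OF cont_w] continuous_intros) auto
    show "w (c + x) = 0" if "norm x \<ge> r + norm c" for x
      using that norm_diff_ineq[of x c] by (intro support) (simp add: add.commute)
  qed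
  have shift: "(LINT x|lborel. w (c + x)) = (LINT x|lborel. w x)" for c
    using integral_distr[of "(+) c" lborel borel w] cont_w lborel_distr_plus[of c]
    by (simp add: borel_measurable_continuous_onI)
  have "(LINT x|lborel. q n x) = 0" for n
    using shift_int[of "s n *\<^sub>R v"] shift_int[of 0] shift[of "s n *\<^sub>R v"]
    by (simp add: q_def[abs_def] add.commute)
  moreover have "(\<lambda>n. LINT x|lborel. q n x) \<longlonglongrightarrow> (LINT x|lborel. D x)"
  proof (rule integral_dominated_convergence)
    show "D \<in> borel_measurable lborel" "q n \<in> borel_measurable lborel" for n
      using cont_D[of UNIV] shift_int[of "s n *\<^sub>R v"] shift_int[of 0]
      by (auto simp: q_def[abs_def] add.commute[of _ "s n *\<^sub>R v"] borel_measurable_continuous_onI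
          intro!: borel_measurable_divide borel_measurable_diff borel_measurable_integrable)
    show "integrable lborel (\<lambda>x. M * indicator (cball 0 (r + norm v)) x)"
      by (intro integrable_mult_right integrable_real_indicator)
        (use emeasure_bounded_finite[OF bounded_cball] in auto)
    show "AE x in lborel. (\<lambda>n. q n x) \<longlonglongrightarrow> D x"
    proof (rule AE_I2)
      fix x
      have "((\<lambda>h. (w (x + h *\<^sub>R v) - w x) / h) \<longlongrightarrow> D x) (at 0)"
        using deriv[of x 0] by (simp add: DERIV_def)
      from filterlim_compose[OF this s_lim] show "(\<lambda>n. q n x) \<longlonglongrightarrow> D x"
        by (simp add: q_def)
    qed
    show "AE x in lborel. norm (q n x) \<le> M * indicator (cball 0 (r + norm v)) x" for n
    proof (rule AE_I2)
      fix x
      have sv: "norm (s' *\<^sub>R v) \<le> norm v" if "0 \<le> s'" "s' \<le> s n" for s'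
        using that s(2)[of n] by (simp add: mult_left_le_one_le)
      show "norm (q n x) \<le> M * indicator (cball 0 (r + norm v)) x"
      proof (cases "norm x \<le> r + norm v")
        case True
        obtain z where z: "0 < z" "z < s n" "w (x + s n *\<^sub>R v) - w x = s n * D (x + z *\<^sub>R v)"
          using MVT2[of 0 "s n" "\<lambda>t. w (x + t *\<^sub>R v)" "\<lambda>t. D (x + t *\<^sub>R v)"] deriv s(1)[of n]
          by auto
        then have "q n x = D (x + z *\<^sub>R v)"
          using s(1)[of n] by (simp add: q_def)
        moreover have "norm (x + z *\<^sub>R v) \<le> r + 2 * norm v"
          using True sv[of z] z norm_triangle_ineq[of x "z *\<^sub>R v"] by linarith
        ultimately show ?thesis using M True by simp
      next
        case False
        then have "norm (x + s n *\<^sub>R v) \<ge> r" "norm x \<ge> r"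
          using sv[of "s n"] s(1)[of n] norm_diff_ineq[of x "s n *\<^sub>R v"] norm_ge_zero[of v]
          by linarith+
        then show ?thesis using False by (simp add: q_def support)
      qed
    qed
  qed
  ultimately show ?thesis
    by (simp add: LIMSEQ_const_iff D_def)
qed

definition classical_gradient :: "('a::euclidean_space \<Rightarrow> real) \<Rightarrow> 'a \<Rightarrow> 'a" where
  "classical_gradient u x = (\<Sum>b\<in>Basis. frechet_derivative u (at x) b *\<^sub>R b)"

lemma classical_gradient_inner:
  assumes "u differentiable (at x)"
  shows "classical_gradient u x \<bullet> v = frechet_derivative u (at x) v"
proof -
  have "frechet_derivative u (at x) v = frechet_derivative u (at x) (\<Sum>b\<in>Basis. (v \<bullet> b) *\<^sub>R b)"
    by (simp add: euclidean_representation)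
  also have "\<dots> = (\<Sum>b\<in>Basis. (v \<bullet> b) * frechet_derivative u (at x) b)"
    using linear_frechet_derivative[OF assms] by (simp add: linear_sum linear_scale)
  finally show ?thesis
    unfolding classical_gradient_def inner_sum_left inner_scaleR_left
    by (simp add: inner_commute mult.commute)
qed

lemma test_function_C_k: "test_function \<phi> \<Longrightarrow> C_k k \<phi>"
  by (simp add: test_function_def)

lemma test_function_derivative:
  assumes "test_function \<phi>"
  shows "\<phi> differentiable (at x)"
    and "test_function (\<lambda>x. frechet_derivative \<phi> (at x) v)"
proof -
  show "\<phi> differentiable (at x)" for x
    using test_function_C_k[OF assms, of "Suc 0"] by simp
  obtain r where r: "\<And>x. norm x \<ge> r \<Longrightarrow> \<phi> x = 0"
    using test_functionE[OF assms] by blast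
  have "frechet_derivative \<phi> (at x) v = 0" if "x \<notin> cball 0 r" for x
  proof -
    have "(\<phi> has_derivative (\<lambda>_. 0)) (at x)"
      by (rule has_derivative_transform_within_open[of "\<lambda>_. 0" _ _ _ "- cball 0 r"])
        (use that r in auto)
    then show ?thesis by (rule frechet_derivative_eqI)
  qed
  moreover have "C_k k (\<lambda>x. frechet_derivative \<phi> (at x) v)" for k
    using test_function_C_k[OF assms, of "Suc k"] by simp
  ultimately show "test_function (\<lambda>x. frechet_derivative \<phi> (at x) v)"
    by (intro test_functionI[of _ "cball 0 r"]) auto
qed

lemma test_function_mult:
  assumes "test_function \<phi>" "test_function \<psi>"
  shows "test_function (\<lambda>x. \<phi> x * \<psi> x)"
proof -
  obtain r where "\<And>x. norm x \<ge> r \<Longrightarrow> \<phi> x = 0"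
    using test_functionE[OF assms(1)] by blast
  then show ?thesis
    by (intro test_functionI[of _ "cball 0 r"] C_k_mult assms[THEN test_function_C_k]) auto
qed

lemma test_function_integrable:
  assumes "test_function \<phi>"
  shows "integrable lebesgue \<phi>"
proof -
  have "locally_integrable (\<lambda>_::'a. 1 :: real)"
    by (rule continuous_locally_integrable) simp
  from locally_integrable_mult_test_function[OF this assms] show ?thesis by simp
qed

text \<open>The derivative of the product \<open>u x * \<phi> x\<close> has integral 0, and the
  product rule splits it into the two sides of the identity.\<close>

lemma test_function_has_weak_gradient:
  assumes u: "test_function u"
  shows "has_weak_gradient u (classical_gradient u)"
  unfolding has_weak_gradient_def
proof (intro conjI allI impI)
  show "locally_integrable u"
    by (intro continuous_locally_integrable test_function_continuous u)
  show "locally_integrable (classical_gradient u)"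
    unfolding classical_gradient_def[abs_def]
    by (intro continuous_locally_integrable continuous_intros test_function_continuous
        test_function_derivative u)
  fix \<phi> :: "'a \<Rightarrow> real" and v assume \<phi>: "test_function \<phi>"
  note diff = test_function_derivative(1)[OF u] test_function_derivative(1)[OF \<phi>]
  have u\<phi>: "test_function (\<lambda>x. u x * \<phi> x)"
    by (intro test_function_mult u \<phi>)
  have product_rule: "frechet_derivative (\<lambda>x. u x * \<phi> x) (at x) v
      = u x * frechet_derivative \<phi> (at x) v + (classical_gradient u x \<bullet> v) * \<phi> x" for x
    using diff[of x] by (simp add: frechet_derivative_eqI[OF has_derivative_mult]
        frechet_derivative_works[symmetric] classical_gradient_inner)
  obtain r where "\<And>x. norm x \<ge> r \<Longrightarrow> u x * \<phi> x = 0"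
    using test_functionE[OF u\<phi>] by blast
  then have "0 = (LINT x|lborel. frechet_derivative (\<lambda>x. u x * \<phi> x) (at x) v)"
    using integral_frechet_derivative_eq_0[of "\<lambda>x. u x * \<phi> x" r v] test_function_C_k[OF u\<phi>]
    by simp
  also have "\<dots> = (LINT x|lebesgue. frechet_derivative (\<lambda>x. u x * \<phi> x) (at x) v)"
    using test_function_continuous[OF test_function_derivative(2)[OF u\<phi>]]
    by (intro integral_completion[symmetric]) (simp add: borel_measurable_continuous_onI)
  also have "\<dots> = (LINT x|lebesgue. u x * frechet_derivative \<phi> (at x) v)
      + (LINT x|lebesgue. (classical_gradient u x \<bullet> v) * \<phi> x)"
    unfolding product_rule
    using u \<phi> test_function_derivative(2)[OF u, of v] test_function_derivative(2)[OF \<phi>, of v]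
    by (intro Bochner_Integration.integral_add)
      (simp_all add: classical_gradient_inner diff test_function_integrable test_function_mult)
  finally show "(LINT x|lebesgue. u x * frechet_derivative \<phi> (at x) v)
      = - (LINT x|lebesgue. (classical_gradient u x \<bullet> v) * \<phi> x)"
    by simp
qed

lemma test_function_W12:
  fixes u :: "'a::euclidean_space \<Rightarrow> real"
  assumes u: "test_function u"
  shows "u \<in> W12"
proof -
  have "u \<in> L2"
    using borel_measurable_integrable[OF test_function_integrable[OF u]]
      test_function_integrable[OF test_function_mult[OF u u]]
    by (simp add: L2_def power2_eq_square)
  moreover have "classical_gradient u \<in> L2"
  proof -
    have norm: "(norm (classical_gradient u x))\<^sup>2 = (\<Sum>b\<in>Basis. frechet_derivative u (at x) b * frechet_derivative u (at x) b)" for x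
      by (subst power2_norm_eq_inner, subst euclidean_inner)
        (simp add: classical_gradient_inner[OF test_function_derivative(1)[OF u]])
    have "integrable lebesgue (\<lambda>x. (norm (classical_gradient u x))\<^sup>2)"
      unfolding norm
      by (intro Bochner_Integration.integrable_sum test_function_integrable test_function_mult
          test_function_derivative u)
    moreover have "classical_gradient u \<in> borel_measurable lebesgue"
      using test_function_has_weak_gradient[OF u]
      by (auto simp: has_weak_gradient_def intro: locally_integrable_measurable)
    ultimately show ?thesis by (simp add: L2_def)
  qed
  ultimately show ?thesis
    using test_function_has_weak_gradient[OF u] by (auto simp: W12_def)
qed

subsection \<open>The Cantor set\<close>

definition cantor_stage :: "nat \<Rightarrow> real set" where
  "cantor_stage n = (\<Union>(a, b)\<in>cantor_intervals n. {a..b})"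

lemma cantor_F_eq: "cantor_F = (\<Inter>n. cantor_stage n)"
  by (simp add: cantor_F_def cantor_stage_def)

lemma cantor_intervals_SucE:
  assumes "(a', b') \<in> cantor_intervals (Suc n)"
  obtains a b where "(a, b) \<in> cantor_intervals n"
    "a' = a \<and> b' = (a + b) / 2 - (1 / 10) ^ Suc n / 2 \<or>
     a' = (a + b) / 2 + (1 / 10) ^ Suc n / 2 \<and> b' = b"
  using assms by auto

text \<open>The closed form solves L(n+1) = (L(n) - 10^-(n+1)) / 2 with L(0) = 1. The coefficient
  7/8 is the total length that survives.\<close>

lemma cantor_intervals_length:
  "(a, b) \<in> cantor_intervals n \<Longrightarrow> b - a = 7 / 8 * (1 / 2) ^ n + 1 / 8 * (1 / 10) ^ n"
proof (induction n arbitrary: a b)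
  case (Suc n)
  obtain c d where cd: "(c, d) \<in> cantor_intervals n"
    "a = c \<and> b = (c + d) / 2 - (1 / 10) ^ Suc n / 2 \<or>
     a = (c + d) / 2 + (1 / 10) ^ Suc n / 2 \<and> b = d"
    by (rule cantor_intervals_SucE[OF Suc.prems])
  from cd(2) have "b - a = (d - c) / 2 - (1 / 10) ^ Suc n / 2"
    by (auto simp: field_simps)
  then show ?case
    unfolding Suc.IH[OF cd(1)] by (simp add: add_divide_distrib)
qed simp

text \<open>A stage-n interval has length at least 10^-n, so removing the next gap leaves two
  nondegenerate intervals inside the parent.\<close>

lemma cantor_intervals_gap_less:
  assumes "(a, b) \<in> cantor_intervals n"
  shows "(1 / 10) ^ Suc n < b - a"
proof -
  have "(1 / 10 :: real) ^ n \<le> (1 / 2) ^ n" "(0::real) < (1 / 10) ^ n"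
    by (intro power_mono) auto
  then show ?thesis
    using cantor_intervals_length[OF assms] by (simp only: power_Suc)
qed

text \<open>Siblings are kept apart by the removed gap, all other pairs by their parents. Hence a
  point determines the interval of a given stage that contains it.\<close>

lemma cantor_intervals_separated:
  assumes "(a, b) \<in> cantor_intervals n" "(c, d) \<in> cantor_intervals n"
  shows "(a, b) = (c, d) \<or> b < c \<or> d < a"
  using assms
proof (induction n arbitrary: a b c d)
  case (Suc n)
  obtain a' b' where ab: "(a', b') \<in> cantor_intervals n"
    "a = a' \<and> b = (a' + b') / 2 - (1 / 10) ^ Suc n / 2 \<or>
     a = (a' + b') / 2 + (1 / 10) ^ Suc n / 2 \<and> b = b'"
    by (rule cantor_intervals_SucE[OF Suc.prems(1)])
  obtain c' d' where cd: "(c', d') \<in> cantor_intervals n"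
    "c = c' \<and> d = (c' + d') / 2 - (1 / 10) ^ Suc n / 2 \<or>
     c = (c' + d') / 2 + (1 / 10) ^ Suc n / 2 \<and> d = d'"
    by (rule cantor_intervals_SucE[OF Suc.prems(2)])
  have pos: "(0::real) < (1 / 10) ^ Suc n" by simp
  note gaps = cantor_intervals_gap_less[OF ab(1)] cantor_intervals_gap_less[OF cd(1)]
  from Suc.IH[OF ab(1) cd(1)] show ?case
  proof
    assume "(a', b') = (c', d')"
    with ab(2) cd(2) pos gaps show ?thesis by (auto simp del: power_Suc)
  next
    assume *: "b' < c' \<or> d' < a'"
    have "a' \<le> a" "b \<le> b'" "c' \<le> c" "d \<le> d'"
      using ab(2) cd(2) pos gaps by argo+
    with * show ?thesis by linarith
  qed
qed simp

lemma finite_cantor_intervals: "finite (cantor_intervals n)"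
  by (induction n) auto

lemma card_cantor_intervals: "card (cantor_intervals n) \<le> 2 ^ n"
proof (induction n)
  case (Suc n)
  have "card (cantor_intervals (Suc n)) \<le> (\<Sum>p\<in>cantor_intervals n. 2)"
    unfolding cantor_intervals.simps
    by (rule order_trans[OF card_UN_le[OF finite_cantor_intervals]], rule sum_mono)
      (auto simp: card_insert_if)
  with Suc show ?case by simp
qed simp

lemma compact_cantor_F: "compact cantor_F"
proof -
  have "closed (cantor_stage n)" for n
    unfolding cantor_stage_def by (intro closed_UN finite_cantor_intervals) auto
  then have "closed cantor_F" unfolding cantor_F_eq by blast
  moreover have "cantor_F \<subseteq> cantor_stage 0" unfolding cantor_F_eq by blast
  ultimately show ?thesis
    by (auto simp: cantor_stage_def compact_eq_bounded_closed intro: bounded_subset[OF bounded_closed_interval])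
qed

lemma cantor_F_subset: "cantor_F \<subseteq> {0..1}"
proof -
  have "cantor_F \<subseteq> cantor_stage 0" unfolding cantor_F_eq by blast
  then show ?thesis by (simp add: cantor_stage_def)
qed

text \<open>An interval inside F cannot jump over a removed gap, so at each stage it stays within a
  single interval.\<close>

lemma interval_subset_cantor_F:
  assumes "{p..q} \<subseteq> cantor_F" "p \<le> q"
  shows "\<exists>(a, b)\<in>cantor_intervals n. a \<le> p \<and> q \<le> b"
proof (induction n)
  case 0
  have "p \<in> {p..q}" "q \<in> {p..q}" using assms(2) by auto
  then have "p \<in> {0..1}" "q \<in> {0..1}" using assms(1) cantor_F_subset by blast+
  then show ?case by simp
next
  case (Suc n)
  then obtain a b where ab: "(a, b) \<in> cantor_intervals n" "a \<le> p" "q \<le> b" by blast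
  define e :: real where "e = (1 / 10) ^ Suc n"
  have "e > 0" by (simp add: e_def)
  \<comment> \<open>A point of \<open>{p..q}\<close> survives the next removal, and by separation
    its surviving interval must be a child of \<open>(a, b)\<close>.\<close>
  have child: "t \<le> (a + b) / 2 - e / 2 \<or> (a + b) / 2 + e / 2 \<le> t" if t: "t \<in> {p..q}" for t
  proof -
    have "t \<in> cantor_stage (Suc n)" using assms t unfolding cantor_F_eq by blast
    then obtain a' b' where a'b': "(a', b') \<in> cantor_intervals (Suc n)" "a' \<le> t" "t \<le> b'"
      by (auto simp: cantor_stage_def simp del: cantor_intervals.simps)
    obtain c d where cd: "(c, d) \<in> cantor_intervals n"
      "a' = c \<and> b' = (c + d) / 2 - (1 / 10) ^ Suc n / 2 \<or>
       a' = (c + d) / 2 + (1 / 10) ^ Suc n / 2 \<and> b' = d"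
      by (rule cantor_intervals_SucE[OF a'b'(1)])
    have "c \<le> t" "t \<le> d"
      using cd(2) a'b'(2,3) cantor_intervals_gap_less[OF cd(1)] \<open>e > 0\<close>
      unfolding e_def[symmetric] by argo+
    with t ab have "\<not> b < c" "\<not> d < a" by auto
    then have "(c, d) = (a, b)"
      using cantor_intervals_separated[OF cd(1) ab(1)] by auto
    with cd(2) a'b'(2,3) show ?thesis by (auto simp: e_def simp del: power_Suc)
  qed
  have "(a, (a + b) / 2 - e / 2) \<in> cantor_intervals (Suc n)"
    "((a + b) / 2 + e / 2, b) \<in> cantor_intervals (Suc n)"
    using ab(1) unfolding cantor_intervals.simps e_def by blast+
  moreover have "q \<le> (a + b) / 2 - e / 2 \<or> (a + b) / 2 + e / 2 \<le> p"
  proof -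
    \<comment> \<open>The midpoint lies in the gap, so \<open>p\<close> and \<open>q\<close> are on
      the same side of it.\<close>
    have "(a + b) / 2 \<notin> {p..q}"
    proof
      assume "(a + b) / 2 \<in> {p..q}"
      from child[OF this] \<open>e > 0\<close> show False by linarith
    qed
    then consider "q < (a + b) / 2" | "(a + b) / 2 < p" by fastforce
    then show ?thesis
      using child[of p] child[of q] assms(2) \<open>e > 0\<close> by cases auto
  qed
  ultimately show ?case using ab(2,3) by blast
qed

text \<open>The intervals of stage n have lengths tending to 0, so none of them can contain a fixed
  nondegenerate interval for every n.\<close>

lemma cantor_F_gap:
  assumes "p < q"
  shows "\<exists>t. p < t \<and> t < q \<and> t \<notin> cantor_F"
proof (rule ccontr)
  assume no_gap: "\<not> ?thesis"
  \<comment> \<open>The middle third turns the open interval free of gaps into a closed one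
    contained in F.\<close>
  define p' q' where "p' = (2 * p + q) / 3" and "q' = (p + 2 * q) / 3"
  have less: "p < p'" "p' < q'" "q' < q" using assms by (auto simp: p'_def q'_def)
  then have sub: "{p'..q'} \<subseteq> cantor_F" using no_gap by force
  have bound: "q' - p' \<le> 7 / 8 * (1 / 2) ^ n + 1 / 8 * (1 / 10) ^ n" for n
  proof -
    obtain a b where "(a, b) \<in> cantor_intervals n" "a \<le> p'" "q' \<le> b"
      using interval_subset_cantor_F[OF sub, of n] less by auto
    then show ?thesis using cantor_intervals_length[of a b n] by linarith
  qed
  have "(\<lambda>n. 7 / 8 * (1 / 2) ^ n + 1 / 8 * (1 / 10) ^ n) \<longlonglongrightarrow> (7 / 8 * 0 + 1 / 8 * 0 :: real)"
    by (intro tendsto_intros LIMSEQ_power_zero) auto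
  then have "q' - p' \<le> 0"
    using bound by (intro LIMSEQ_le_const) auto
  with less show False by simp
qed

text \<open>At most 2^n gaps of length 10^-(n+1) disappear after stage n. Their total is at most
  (1/10) / (1 - 1/5) = 1/8, less than the length of [0, 1].\<close>

lemma emeasure_cantor_F_pos: "0 < emeasure lborel cantor_F"
proof (rule ccontr)
  assume "\<not> ?thesis"
  then have null: "emeasure lborel cantor_F = 0" by simp
  define J where "J n = (\<lambda>(a, b). {(a + b) / 2 - (1 / 10) ^ Suc n / 2 <..< (a + b) / 2 + (1 / 10) ^ Suc n / 2 :: real})" for n
  define gaps where "gaps n = (\<Union>p\<in>cantor_intervals n. J n p)" for n
  have J: "J n p \<in> sets lborel" "emeasure lborel (J n p) = ennreal ((1 / 10) ^ Suc n)" for n p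
    by (auto simp: J_def split: prod.splits)
  have cover: "t \<in> cantor_F" if t: "t \<in> {0..1}" "t \<notin> (\<Union>n. gaps n)" for t
  proof -
    have "t \<in> cantor_stage n" for n
    proof (induction n)
      case 0
      then show ?case using t by (simp add: cantor_stage_def)
    next
      case (Suc n)
      then obtain a b where ab: "(a, b) \<in> cantor_intervals n" "a \<le> t" "t \<le> b"
        by (auto simp: cantor_stage_def)
      with t have "t \<notin> J n (a, b)" unfolding gaps_def by blast
      with ab(2,3) have "t \<in> {a..(a + b) / 2 - (1 / 10) ^ Suc n / 2}
          \<union> {(a + b) / 2 + (1 / 10) ^ Suc n / 2..b}"
        by (auto simp: J_def simp del: power_Suc)
      moreover have "(a, (a + b) / 2 - (1 / 10) ^ Suc n / 2) \<in> cantor_intervals (Suc n)"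
        "((a + b) / 2 + (1 / 10) ^ Suc n / 2, b) \<in> cantor_intervals (Suc n)"
        using ab(1) unfolding cantor_intervals.simps by blast+
      ultimately show ?case
        unfolding cantor_stage_def by blast
    qed
    then show ?thesis by (simp add: cantor_F_eq)
  qed
  have gaps: "gaps n \<in> sets lborel" "emeasure lborel (gaps n) \<le> ennreal (1 / 10 * (1 / 5) ^ n)" for n
  proof -
    show "gaps n \<in> sets lborel"
      unfolding gaps_def using J(1) finite_cantor_intervals by (intro sets.finite_UN) auto
    have "emeasure lborel (gaps n) \<le> (\<Sum>p\<in>cantor_intervals n. emeasure lborel (J n p))"
      unfolding gaps_def by (intro emeasure_subadditive_finite finite_cantor_intervals) (use J in auto)
    also have "\<dots> = ennreal (real (card (cantor_intervals n)) * (1 / 10) ^ Suc n)"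
      by (simp only: J(2) sum_constant ennreal_of_nat_eq_real_of_nat)
        (simp only: ennreal_mult' of_nat_0_le_iff)
    also have "\<dots> \<le> ennreal (2 ^ n * (1 / 10) ^ Suc n)"
      using of_nat_mono[OF card_cantor_intervals[of n], where 'a = real]
      by (intro ennreal_leI mult_right_mono) simp_all
    also have "2 ^ n * (1 / 10) ^ Suc n = (1 / 10 * (1 / 5) ^ n :: real)"
      using power_mult_distrib[of 2 "1 / 10 :: real" n] by simp
    finally show "emeasure lborel (gaps n) \<le> ennreal (1 / 10 * (1 / 5) ^ n)" .
  qed
  have F: "cantor_F \<in> sets lborel"
    using compact_cantor_F by (simp add: borel_compact)
  have "1 = emeasure lborel {0..1 :: real}" by simp
  also have "\<dots> \<le> emeasure lborel (cantor_F \<union> (\<Union>n. gaps n))"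
    using cover F gaps(1) by (intro emeasure_mono) auto
  also have "\<dots> \<le> emeasure lborel cantor_F + emeasure lborel (\<Union>n. gaps n)"
    using F gaps(1) by (intro emeasure_subadditive) auto
  also have "\<dots> \<le> (\<Sum>n. emeasure lborel (gaps n))"
    using gaps(1) null by (simp add: emeasure_subadditive_countably image_subset_iff)
  also have "\<dots> \<le> (\<Sum>n. ennreal (1 / 10 * (1 / 5) ^ n))"
    by (intro suminf_le gaps) auto
  also have "\<dots> = ennreal (1 / 10 * (1 / (1 - 1 / 5)))"
    by (intro suminf_ennreal_eq sums_mult geometric_sums) auto
  also have "\<dots> < 1" by (simp add: ennreal_less_one_iff)
  finally show False by simp
qed

subsection \<open>Bounded weak gradients and Lipschitz bounds\<close>

lemma lborel_product_function:
  fixes f g :: "real \<Rightarrow> real"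
  assumes f: "integrable lborel f" and g: "integrable lborel g"
  shows "integrable lborel (\<lambda>z. f (fst z) * g (snd z))"
    and "(LINT z|lborel. f (fst z) * g (snd z)) = (LINT x|lborel. f x) * (LINT y|lborel. g y)"
proof -
  have meas: "f \<in> borel_measurable lborel" "g \<in> borel_measurable lborel"
    using f g by auto
  have int: "integrable (lborel \<Otimes>\<^sub>M lborel) (\<lambda>z. f (fst z) * g (snd z))"
  proof (rule lborel_pair.Fubini_integrable)
    show "(\<lambda>z. f (fst z) * g (snd z)) \<in> borel_measurable (lborel \<Otimes>\<^sub>M lborel)"
      using meas by measurable
    show "integrable lborel (\<lambda>x. LINT y|lborel. norm (f (fst (x, y)) * g (snd (x, y))))"
      using f by (simp add: abs_mult)
    show "AE x in lborel. integrable lborel (\<lambda>y. f (fst (x, y)) * g (snd (x, y)))"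
      using g by simp
  qed
  then show "integrable lborel (\<lambda>z. f (fst z) * g (snd z))"
    by (simp add: lborel_prod)
  show "(LINT z|lborel. f (fst z) * g (snd z)) = (LINT x|lborel. f x) * (LINT y|lborel. g y)"
    using lborel_pair.integral_fst'[OF int] by (simp add: lborel_prod)
qed

text \<open>Leaving open which coordinate vector is \<open>i\<close> and which is \<open>j\<close>
  lets one argument treat vertical and horizontal lines alike.\<close>

lemma lborel_product_function_axes:
  fixes f g :: "real \<Rightarrow> real" and i j :: "real \<times> real"
  assumes f: "integrable lborel f" and g: "integrable lborel g"
    and ij: "(i, j) = ((1, 0), (0, 1)) \<or> (i, j) = ((0, 1), (1, 0))"
  shows "integrable lborel (\<lambda>z. f (z \<bullet> i) * g (z \<bullet> j))"
    and "(LINT z|lborel. f (z \<bullet> i) * g (z \<bullet> j)) = (LINT x|lborel. f x) * (LINT y|lborel. g y)"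
  using ij lborel_product_function[OF f g] lborel_product_function[OF g f]
  by (auto simp: inner_prod_def mult.commute)

text \<open>
  The weak gradient is tested against \<open>\<eta> (z \<bullet> i) * \<psi> (z \<bullet> j)\<close>, where \<open>\<eta>\<close> concentrates at \<open>t\<close> and \<open>\<psi>\<close> is
  a smoothed indicator of \<open>{c..d}\<close>, whose derivative is a difference of approximate point masses at
  \<open>c\<close> and \<open>d\<close>.
\<close>

lemma weak_gradient_line_bound:
  fixes u :: "real \<times> real \<Rightarrow> real" and i j :: "real \<times> real"
  assumes ij: "(i, j) = ((1, 0), (0, 1)) \<or> (i, j) = ((0, 1), (1, 0))"
    and cont: "continuous_on UNIV u" and wg: "has_weak_gradient u g"
    and T: "open T" "t \<in> T" and bound: "AE z in lebesgue. z \<bullet> i \<in> T \<longrightarrow> norm (g z) \<le> 1"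
    and cd: "c < d"
  shows "\<bar>u (t *\<^sub>R i + c *\<^sub>R j) - u (t *\<^sub>R i + d *\<^sub>R j)\<bar> \<le> d - c"
proof (rule field_le_epsilon)
  fix \<epsilon> :: real assume "\<epsilon> > 0"
  have norm_ij: "norm i = 1" "norm j = 1" "i \<bullet> i = 1" "j \<bullet> j = 1" "i \<bullet> j = 0" "j \<bullet> i = 0"
    and rep: "z = (z \<bullet> i) *\<^sub>R i + (z \<bullet> j) *\<^sub>R j" for z
    using ij by (auto simp: inner_prod_def norm_prod_def)
  define p where "p s = t *\<^sub>R i + s *\<^sub>R j" for s
  have near: "\<exists>r>0. \<forall>z. dist z (p s) < r \<longrightarrow> \<bar>u z - u (p s)\<bar> < \<epsilon> / 4" for s
    using cont \<open>\<epsilon> > 0\<close> unfolding continuous_on_iff dist_real_def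
    by (metis UNIV_I divide_pos_pos zero_less_numeral)
  obtain r1 where r1: "r1 > 0" "\<And>z. dist z (p c) < r1 \<Longrightarrow> \<bar>u z - u (p c)\<bar> < \<epsilon> / 4"
    using near by blast
  obtain r2 where r2: "r2 > 0" "\<And>z. dist z (p d) < r2 \<Longrightarrow> \<bar>u z - u (p d)\<bar> < \<epsilon> / 4"
    using near by blast
  obtain r3 where r3: "r3 > 0" "ball t r3 \<subseteq> T"
    using T open_contains_ball by blast
  \<comment> \<open>The weights used below live on rectangles with sides \<open>3 * \<delta>\<close>
    and \<open>\<delta>\<close>, within \<open>4 * \<delta>\<close> of \<open>p c\<close> or
    \<open>p d\<close>. The factors 1/5 keep them where \<open>u\<close> varies by less than
    \<open>\<epsilon> / 4\<close>, and \<open>r3 / 4\<close> keeps them over \<open>T\<close>. The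
    bound \<open>\<epsilon> / 2\<close> pays for the overhang of \<psi> beyond
    \<open>d\<close>.\<close>
  define \<delta> where "\<delta> = min (r1 / 5) (min (r2 / 5) (min (r3 / 4) (min (\<epsilon> / 2) (d - c))))"
  have \<delta>: "\<delta> > 0" "\<delta> \<le> r1 / 5" "\<delta> \<le> r2 / 5" "\<delta> \<le> r3 / 4" "\<delta> \<le> \<epsilon> / 2" "\<delta> \<le> d - c"
    using r1(1) r2(1) r3(1) \<open>\<epsilon> > 0\<close> cd unfolding \<delta>_def by linarith+
  obtain h h' :: "real \<Rightarrow> real" where h: "\<And>k. C_k k h"
    "\<And>t. (h has_real_derivative h' t) (at t)" "\<And>t. 0 \<le> h' t" "continuous_on UNIV h'"
    "\<And>t. 0 \<le> h t" "\<And>t. h t \<le> 1" "\<And>t. t \<le> 0 \<Longrightarrow> h t = 0" "\<And>t. t \<ge> 1 \<Longrightarrow> h t = 1"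
    using smooth_step_exists by blast
  have h'_0: "h' s = 0" if "s < 0 \<or> s > 1" for s
    using that
  proof
    assume "s < 0"
    have "((\<lambda>_. 0) has_real_derivative h' s) (at s)"
      by (rule has_field_derivative_transform_within_open[OF h(2), where S = "{..<0}"])
        (use \<open>s < 0\<close> h in auto)
    then show ?thesis using DERIV_const DERIV_unique by blast
  next
    assume "s > 1"
    have "((\<lambda>_. 1) has_real_derivative h' s) (at s)"
      by (rule has_field_derivative_transform_within_open[OF h(2), where S = "{1<..}"])
        (use \<open>s > 1\<close> h in auto)
    then show ?thesis using DERIV_const DERIV_unique by blast
  qed
  have cont_h: "continuous_on UNIV h" using h(1)[of 0] by simp

  have Ck_step: "C_k k (\<lambda>s. h ((s - a) / e))" for k a e
    using C_k_affine[OF h(1) bounded_linear_divide, of k e "- a / e"] by (simp add: diff_divide_distrib)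
  \<comment> \<open>A smooth plateau: it rises on [t, t + \<delta>], equals 1 up to t + 2\<delta>
    and is back at 0 at t + 3\<delta>. The negative width in the second factor reverses the step.
    Its mass \<open>X\<close> is positive and cancels in the end.\<close>
  define \<eta> where "\<eta> s = h ((s - t) / \<delta>) * h ((s - (t + 3 * \<delta>)) / - \<delta>)" for s
  have \<eta>_Ck: "C_k k \<eta>" for k
    unfolding \<eta>_def[abs_def] by (intro C_k_mult Ck_step)
  have \<eta>_nonneg: "0 \<le> \<eta> s" for s
    by (simp add: \<eta>_def h)
  have \<eta>_support: "t \<le> s \<and> s \<le> t + 3 * \<delta>" if "\<eta> s \<noteq> 0" for s
  proof (rule ccontr)
    assume "\<not> ?thesis"
    then have "(s - t) / \<delta> \<le> 0 \<or> (s - (t + 3 * \<delta>)) / - \<delta> \<le> 0"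
      using \<delta>(1) by (auto simp: divide_nonpos_pos divide_nonneg_neg simp del: minus_divide_right divide_minus_right)
    then have "\<eta> s = 0" unfolding \<eta>_def using h(7) by auto
    with that show False by simp
  qed
  have \<eta>_1: "\<eta> s = 1" if "t + \<delta> \<le> s" "s \<le> t + 2 * \<delta>" for s
  proof -
    have "1 \<le> (s - t) / \<delta>" "1 \<le> (s - (t + 3 * \<delta>)) / - \<delta>"
      using that \<delta>(1) by (simp_all add: le_divide_eq_1 divide_le_eq)
    then show ?thesis unfolding \<eta>_def using h(8) by simp
  qed
  have \<eta>_cont: "continuous_on UNIV \<eta>"
    using \<eta>_Ck[of 0] by simp
  have \<eta>_int: "integrable lborel \<eta>"
  proof (rule continuous_compact_support_integrable[OF \<eta>_cont])
    show "\<eta> s = 0" if "norm s \<ge> \<bar>t\<bar> + 3 * \<delta> + 1" for s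
      using \<eta>_support[of s] that \<delta>(1) by (cases "\<eta> s = 0") auto
  qed
  define X where "X = (LINT s|lborel. \<eta> s)"
  have "X > 0"
  proof -
    have "\<delta> = (LINT s|lborel. indicator {t + \<delta>..t + 2 * \<delta>} s)"
      using \<delta>(1) by simp
    also have "\<dots> \<le> X"
      unfolding X_def
    proof (intro integral_mono \<eta>_int integrable_real_indicator)
      show "emeasure lborel {t + \<delta>..t + 2 * \<delta>} < \<infinity>"
        using emeasure_bounded_finite[OF bounded_closed_interval] .
    qed (use \<eta>_nonneg \<eta>_1 in \<open>auto simp: indicator_def\<close>)
    finally show ?thesis using \<delta>(1) by simp
  qed

  \<comment> \<open>A nonnegative weight on [a, a + \<delta>]; its mass is 1 because it is the
    derivative of a step from 0 to 1.\<close>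
  define k where "k a s = h' ((s - a) / \<delta>) / \<delta>" for a s
  have k_nonneg: "0 \<le> k a s" for a s
    using h(3) \<delta>(1) by (simp add: k_def)
  have k_support: "a \<le> s \<and> s \<le> a + \<delta>" if "k a s \<noteq> 0" for a s
  proof (rule ccontr)
    assume "\<not> ?thesis"
    then have "(s - a) / \<delta> < 0 \<or> (s - a) / \<delta> > 1"
      using \<delta>(1) by (auto simp: field_simps)
    with that h'_0[of "(s - a) / \<delta>"] show False by (simp add: k_def)
  qed
  have k_cont: "continuous_on S (k a)" for a S
    unfolding k_def[abs_def] using \<delta>(1)
    by (intro continuous_intros continuous_on_compose2[OF h(4)]) auto
  have step_deriv: "((\<lambda>s. h ((s - a) / \<delta>)) has_real_derivative k a s) (at s)" for a s
  proof -
    have "((\<lambda>s. (s - a) / \<delta>) has_real_derivative 1 / \<delta>) (at s)"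
      using \<delta>(1) by (auto intro!: derivative_eq_intros)
    from DERIV_chain2[OF h(2) this] show ?thesis by (simp add: k_def)
  qed
  have k_int: "integrable lborel (k a)" "(LINT s|lborel. k a s) = 1" for a
  proof -
    have "has_bochner_integral lborel (\<lambda>s. k a s * indicator {a..a + \<delta>} s)
        (h ((a + \<delta> - a) / \<delta>) - h ((a - a) / \<delta>))"
      using \<delta>(1) k_cont[of UNIV a]
      by (intro has_bochner_integral_FTC_Icc_real step_deriv) (auto simp: continuous_on_eq_continuous_at)
    moreover have "(\<lambda>s. k a s * indicator {a..a + \<delta>} s) = k a"
      using k_support[of a] by (fastforce simp: indicator_def)
    ultimately have "has_bochner_integral lborel (k a) 1"
      using \<delta>(1) h(7)[of 0] h(8)[of 1] by simp
    then show "integrable lborel (k a)" "(LINT s|lborel. k a s) = 1"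
      by (auto simp: has_bochner_integral_iff)
  qed

  define \<psi> where "\<psi> s = h ((s - c) / \<delta>) + - 1 * h ((s - d) / \<delta>)" for s
  have \<psi>_Ck: "C_k k \<psi>" for k
    unfolding \<psi>_def[abs_def] by (intro C_k_add C_k_mult C_k_const Ck_step)
  have \<psi>_eq: "\<psi> s = h ((s - c) / \<delta>) - h ((s - d) / \<delta>)" for s
    by (simp add: \<psi>_def)
  have \<psi>_bound: "\<bar>\<psi> s\<bar> \<le> indicator {c..d + \<delta>} s" for s
  proof -
    have "\<psi> s = 0" if "s < c"
      using that cd \<delta>(1) by (simp add: \<psi>_eq h divide_nonpos_pos)
    moreover have "\<psi> s = 0" if "s > d + \<delta>"
      using that cd \<delta>(1) by (simp add: \<psi>_eq h(8))
    moreover have "\<bar>\<psi> s\<bar> \<le> 1"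
      using h(5,6)[of "(s - c) / \<delta>"] h(5,6)[of "(s - d) / \<delta>"] by (simp add: \<psi>_eq abs_le_iff)
    ultimately show ?thesis by (auto simp: indicator_def not_le)
  qed
  have \<psi>_deriv: "(\<psi> has_real_derivative k c s - k d s) (at s)" for s
    unfolding \<psi>_eq[abs_def] by (intro DERIV_diff step_deriv)

  define \<phi> where "\<phi> z = \<eta> (z \<bullet> i) * \<psi> (z \<bullet> j)" for z
  have \<phi>_test: "test_function \<phi>"
  proof (rule test_functionI)
    show "C_k k \<phi>" for k
      unfolding \<phi>_def[abs_def]
      using C_k_affine[OF \<eta>_Ck, of "\<lambda>z. z \<bullet> i" k 0] C_k_affine[OF \<psi>_Ck, of "\<lambda>z. z \<bullet> j" k 0]
      by (intro C_k_mult) (simp_all add: bounded_linear_inner_left)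
    let ?r = "(\<bar>t\<bar> + 3 * \<delta>) + (\<bar>c\<bar> + \<bar>d\<bar> + \<delta>)"
    show "compact (cball (0 :: real \<times> real) ?r)" by simp
    show "\<phi> z = 0" if "z \<notin> cball 0 ?r" for z
    proof (rule ccontr)
      assume "\<phi> z \<noteq> 0"
      then have "\<eta> (z \<bullet> i) \<noteq> 0" "\<psi> (z \<bullet> j) \<noteq> 0" by (auto simp: \<phi>_def)
      then have "t \<le> z \<bullet> i" "z \<bullet> i \<le> t + 3 * \<delta>" "c \<le> z \<bullet> j" "z \<bullet> j \<le> d + \<delta>"
        using \<eta>_support[of "z \<bullet> i"] \<psi>_bound[of "z \<bullet> j"]
        by (cases "z \<bullet> j \<in> {c..d + \<delta>}"; simp)+
      then have "\<bar>z \<bullet> i\<bar> + \<bar>z \<bullet> j\<bar> \<le> ?r"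
        using \<delta>(1) by linarith
      moreover have "norm z \<le> \<bar>z \<bullet> i\<bar> + \<bar>z \<bullet> j\<bar>"
        using norm_triangle_ineq[of "(z \<bullet> i) *\<^sub>R i" "(z \<bullet> j) *\<^sub>R j"] norm_ij
        by (subst rep) simp
      ultimately show False using that by simp
    qed
  qed
  have D\<phi>: "frechet_derivative \<phi> (at z) j = \<eta> (z \<bullet> i) * k c (z \<bullet> j) - \<eta> (z \<bullet> i) * k d (z \<bullet> j)" for z
  proof -
    have "((\<lambda>s. \<phi> (z + s *\<^sub>R j)) has_real_derivative frechet_derivative \<phi> (at z) j) (at 0)"
      using frechet_derivative_along_line[of \<phi> z 0 j] test_function_derivative(1)[OF \<phi>_test] by simp
    moreover have "((\<lambda>s. \<eta> (z \<bullet> i) * \<psi> (z \<bullet> j + s)) has_real_derivative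
        \<eta> (z \<bullet> i) * (k c (z \<bullet> j) - k d (z \<bullet> j))) (at 0)"
      using DERIV_cmult[OF DERIV_shift[THEN iffD1, OF \<psi>_deriv[of "0 + z \<bullet> j"]], of "\<eta> (z \<bullet> i)"]
      by (simp add: add.commute)
    moreover have "(\<lambda>s. \<phi> (z + s *\<^sub>R j)) = (\<lambda>s. \<eta> (z \<bullet> i) * \<psi> (z \<bullet> j + s))"
      using norm_ij by (simp add: \<phi>_def inner_add_left)
    ultimately show ?thesis
      using DERIV_unique by (metis right_diff_distrib)
  qed

  note prod_int = lborel_product_function_axes(1)[OF \<eta>_int k_int(1) ij]
  have prod_X: "(LINT z|lborel. \<eta> (z \<bullet> i) * k a (z \<bullet> j)) = X" for a
    using lborel_product_function_axes(2)[OF \<eta>_int k_int(1) ij] by (simp add: X_def k_int)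
  \<comment> \<open>Averaging: the weight has mass \<open>X\<close> and sits where \<open>u\<close>
    differs from \<open>u (p a)\<close> by less than \<open>\<epsilon> / 4\<close>.\<close>
  have localised: "integrable lborel (\<lambda>z. u z * (\<eta> (z \<bullet> i) * k a (z \<bullet> j)))"
    "\<bar>(LINT z|lborel. u z * (\<eta> (z \<bullet> i) * k a (z \<bullet> j))) - u (p a) * X\<bar> \<le> \<epsilon> / 4 * X"
    if u: "\<And>z. dist z (p a) < 5 * \<delta> \<Longrightarrow> \<bar>u z - u (p a)\<bar> < \<epsilon> / 4" for a
  proof -
    let ?w = "\<lambda>z. \<eta> (z \<bullet> i) * k a (z \<bullet> j)"
    have close: "\<bar>(u z - u (p a)) * ?w z\<bar> \<le> \<epsilon> / 4 * ?w z" for z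
    proof (cases "?w z = 0")
      case False
      then have "t \<le> z \<bullet> i" "z \<bullet> i \<le> t + 3 * \<delta>" "a \<le> z \<bullet> j" "z \<bullet> j \<le> a + \<delta>"
        using \<eta>_support[of "z \<bullet> i"] k_support[of a "z \<bullet> j"] by auto
      moreover have "z - p a = (z \<bullet> i - t) *\<^sub>R i + (z \<bullet> j - a) *\<^sub>R j"
        by (subst rep) (simp add: p_def algebra_simps)
      then have "dist z (p a) \<le> \<bar>z \<bullet> i - t\<bar> + \<bar>z \<bullet> j - a\<bar>"
        using norm_triangle_ineq[of "(z \<bullet> i - t) *\<^sub>R i" "(z \<bullet> j - a) *\<^sub>R j"] norm_ij
        by (simp add: dist_norm)
      ultimately have "\<bar>u z - u (p a)\<bar> \<le> \<epsilon> / 4"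
        using u[of z] \<delta>(1) by linarith
      then show ?thesis
        using \<eta>_nonneg[of "z \<bullet> i"] k_nonneg[of a "z \<bullet> j"]
          mult_right_mono[of "\<bar>u z - u (p a)\<bar>" "\<epsilon> / 4" "?w z"] by (simp only: abs_mult) simp
    qed (simp only: mult_zero_right abs_zero order_refl)
    have meas: "(\<lambda>z. (u z - u (p a)) * ?w z) \<in> borel_measurable lborel"
      using borel_measurable_continuous_onI[OF cont] borel_measurable_integrable[OF prod_int] by simp
    have int: "integrable lborel (\<lambda>z. (u z - u (p a)) * ?w z)"
      by (rule Bochner_Integration.integrable_bound[OF integrable_mult_right[OF prod_int] meas])
        (use close in \<open>auto intro!: AE_I2 order_trans[OF close] abs_ge_self\<close>)
    have split: "u z * ?w z = (u z - u (p a)) * ?w z + u (p a) * ?w z" for z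
      by (simp add: algebra_simps)
    show "integrable lborel (\<lambda>z. u z * ?w z)"
      unfolding split by (intro Bochner_Integration.integrable_add int integrable_mult_right prod_int)
    have "(LINT z|lborel. u z * ?w z) = (LINT z|lborel. (u z - u (p a)) * ?w z) + u (p a) * X"
      unfolding split
      by (subst Bochner_Integration.integral_add[OF int integrable_mult_right[OF prod_int]])
        (simp add: prod_X)
    moreover have "\<bar>LINT z|lborel. (u z - u (p a)) * ?w z\<bar> \<le> (LINT z|lborel. \<epsilon> / 4 * ?w z)"
      using close by (intro order_trans[OF integral_abs_bound] integral_mono integrable_abs int
          integrable_mult_right prod_int)
    ultimately show "\<bar>(LINT z|lborel. u z * ?w z) - u (p a) * X\<bar> \<le> \<epsilon> / 4 * X"
      by (simp add: prod_X)
  qed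
  have loc_c: "\<And>z. dist z (p c) < 5 * \<delta> \<Longrightarrow> \<bar>u z - u (p c)\<bar> < \<epsilon> / 4"
    and loc_d: "\<And>z. dist z (p d) < 5 * \<delta> \<Longrightarrow> \<bar>u z - u (p d)\<bar> < \<epsilon> / 4"
    using r1(2) r2(2) \<delta>(2,3) by auto
  have "(LINT z|lebesgue. u z * frechet_derivative \<phi> (at z) j)
      = (LINT z|lborel. u z * frechet_derivative \<phi> (at z) j)"
    using test_function_continuous[OF test_function_derivative(2)[OF \<phi>_test]] cont
    by (intro integral_completion borel_measurable_times)
      (simp_all add: borel_measurable_continuous_onI)
  also have "\<dots> = (LINT z|lborel. u z * (\<eta> (z \<bullet> i) * k c (z \<bullet> j)))
      - (LINT z|lborel. u z * (\<eta> (z \<bullet> i) * k d (z \<bullet> j)))"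
    unfolding D\<phi> right_diff_distrib
    by (intro Bochner_Integration.integral_diff localised loc_c loc_d)
  finally have difference: "(LINT z|lebesgue. u z * frechet_derivative \<phi> (at z) j)
      = (LINT z|lborel. u z * (\<eta> (z \<bullet> i) * k c (z \<bullet> j)))
      - (LINT z|lborel. u z * (\<eta> (z \<bullet> i) * k d (z \<bullet> j)))" .
  have lhs: "\<bar>(u (p c) - u (p d)) * X\<bar>
      \<le> \<bar>LINT z|lebesgue. u z * frechet_derivative \<phi> (at z) j\<bar> + \<epsilon> / 2 * X"
  proof -
    have combine: "\<bar>(a - b) * x\<bar> \<le> \<bar>l\<bar> + e / 2 * x"
      if "l = A - B" "\<bar>A - a * x\<bar> \<le> e / 4 * x" "\<bar>B - b * x\<bar> \<le> e / 4 * x"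
      for a b x l e A B :: real
    proof -
      have "(a - b) * x = l - (A - a * x) + (B - b * x)" "e / 2 * x = e / 4 * x + e / 4 * x"
        using that(1) by (simp_all add: algebra_simps)
      with that(2,3) show ?thesis by linarith
    qed
    show ?thesis
      by (rule combine[OF difference localised(2)[OF loc_c] localised(2)[OF loc_d]])
  qed

  have ind_int: "integrable lborel (indicator {c..d + \<delta>} :: real \<Rightarrow> real)"
    using emeasure_bounded_finite[OF bounded_closed_interval[of c "d + \<delta>"]]
    by (intro integrable_real_indicator) auto
  note box_int = lborel_product_function_axes[OF \<eta>_int ind_int ij]
  have "\<bar>LINT z|lebesgue. u z * frechet_derivative \<phi> (at z) j\<bar> = \<bar>LINT z|lebesgue. (g z \<bullet> j) * \<phi> z\<bar>"
  proof -
    have "(LINT z|lebesgue. u z * frechet_derivative \<phi> (at z) j) = - (LINT z|lebesgue. (g z \<bullet> j) * \<phi> z)"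
      using wg \<phi>_test unfolding has_weak_gradient_def by blast
    then show ?thesis by simp
  qed
  also have "\<dots> \<le> (LINT z|lebesgue. \<bar>(g z \<bullet> j) * \<phi> z\<bar>)"
    by (rule integral_abs_bound)
  \<comment> \<open>\<eta> vanishes outside the strip where the gradient is bounded by 1, and \<psi>
    is bounded by 1 with support in [c, d + \<delta>].\<close>
  also have "\<dots> \<le> (LINT z|lebesgue. \<eta> (z \<bullet> i) * indicator {c..d + \<delta>} (z \<bullet> j))"
  proof (rule integral_mono_AE)
    show "integrable lebesgue (\<lambda>z. \<eta> (z \<bullet> i) * indicator {c..d + \<delta>} (z \<bullet> j))"
      using box_int(1) by (simp add: integrable_completion borel_measurable_integrable)
    have loc: "locally_integrable (\<lambda>z. g z \<bullet> j)"
      using wg ij by (auto simp: has_weak_gradient_def locally_integrable_def Basis_prod_def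
          intro!: absolutely_integrable_component)
    show "integrable lebesgue (\<lambda>z. \<bar>(g z \<bullet> j) * \<phi> z\<bar>)"
      using locally_integrable_mult_test_function[OF loc \<phi>_test] by simp
    show "AE z in lebesgue. \<bar>(g z \<bullet> j) * \<phi> z\<bar> \<le> \<eta> (z \<bullet> i) * indicator {c..d + \<delta>} (z \<bullet> j)"
      using bound
    proof eventually_elim
      fix z assume z: "z \<bullet> i \<in> T \<longrightarrow> norm (g z) \<le> 1"
      show "\<bar>(g z \<bullet> j) * \<phi> z\<bar> \<le> \<eta> (z \<bullet> i) * indicator {c..d + \<delta>} (z \<bullet> j)"
      proof (cases "\<eta> (z \<bullet> i) = 0")
        case False
        then have "z \<bullet> i \<in> ball t r3"
          using \<eta>_support[of "z \<bullet> i"] \<delta>(1,4) by (auto simp: dist_real_def)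
        then have "norm (g z) \<le> 1" using z r3(2) by blast
        then have "\<bar>g z \<bullet> j\<bar> \<le> 1"
          using Cauchy_Schwarz_ineq2[of "g z" j] norm_ij by simp
        then have "\<bar>g z \<bullet> j\<bar> * (\<eta> (z \<bullet> i) * \<bar>\<psi> (z \<bullet> j)\<bar>)
            \<le> 1 * (\<eta> (z \<bullet> i) * indicator {c..d + \<delta>} (z \<bullet> j))"
          using \<eta>_nonneg \<psi>_bound by (intro mult_mono mult_left_mono) auto
        then show ?thesis
          using \<eta>_nonneg[of "z \<bullet> i"] by (simp add: \<phi>_def abs_mult)
      qed (simp add: \<phi>_def)
    qed
  qed
  also have "\<dots> = (LINT z|lborel. \<eta> (z \<bullet> i) * indicator {c..d + \<delta>} (z \<bullet> j))"
    using box_int(1) by (intro integral_completion borel_measurable_integrable)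
  also have "\<dots> = X * (d - c + \<delta>)"
    using cd \<delta>(1) by (simp add: box_int(2) X_def)
  finally have "\<bar>(u (p c) - u (p d)) * X\<bar> \<le> X * (d - c + \<delta>) + \<epsilon> / 2 * X"
    using lhs by linarith
  also have "\<bar>(u (p c) - u (p d)) * X\<bar> = \<bar>u (p c) - u (p d)\<bar> * X"
    using \<open>X > 0\<close> by (simp add: abs_mult)
  also have "X * (d - c + \<delta>) + \<epsilon> / 2 * X = (d - c + \<delta> + \<epsilon> / 2) * X"
    by (simp add: algebra_simps)
  finally have "\<bar>u (p c) - u (p d)\<bar> * X \<le> (d - c + \<delta> + \<epsilon> / 2) * X" .
  then have "\<bar>u (p c) - u (p d)\<bar> \<le> d - c + \<delta> + \<epsilon> / 2"
    using \<open>X > 0\<close> by simp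
  then show "\<bar>u (t *\<^sub>R i + c *\<^sub>R j) - u (t *\<^sub>R i + d *\<^sub>R j)\<bar> \<le> d - c + \<epsilon>"
    using \<delta>(5) by (simp add: p_def)
qed

subsection \<open>Approximate Lipschitz constants\<close>

text \<open>The small ball lies inside \<open>ball x r\<close> and fills the fixed fraction
  \<open>(1 / 4) ^ DIM('a)\<close> of it; a set missing it for arbitrarily small r could not have
  density 1 at x.\<close>

lemma point_of_density_meets_ball:
  fixes A :: "'a::euclidean_space set"
  assumes A: "A \<in> sets lebesgue" and density: "point_of_density A x" and e: "norm e = 1"
  shows "\<forall>\<^sub>F r in at_right 0. A \<inter> ball (x + (r / 2) *\<^sub>R e) (r / 4) \<noteq> {}"
proof -
  define \<kappa> :: real where "\<kappa> = (1 / 4) ^ DIM('a)"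
  have \<kappa>: "0 < \<kappa>" by (simp add: \<kappa>_def)
  have "\<forall>\<^sub>F r in at_right 0. 1 - \<kappa> < measure lebesgue (A \<inter> ball x r) / measure lebesgue (ball x r)"
    using density \<kappa> unfolding point_of_density_def by (intro order_tendstoD) auto
  then show ?thesis
  proof (rule eventually_mono[OF eventually_conj[OF _ eventually_at_right_less[of "0 :: real"]]],
      elim conjE)
    fix r :: real
    assume "0 < r" and gt: "1 - \<kappa> < measure lebesgue (A \<inter> ball x r) / measure lebesgue (ball x r)"
    let ?B = "ball (x + (r / 2) *\<^sub>R e) (r / 4)"
    have pos: "0 < measure lebesgue (ball x r)"
      using \<open>0 < r\<close> by (simp add: content_ball unit_ball_vol_pos)
    show "A \<inter> ?B \<noteq> {}"
    proof
      assume disj: "A \<inter> ?B = {}"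
      have sub: "?B \<subseteq> ball x r"
      proof
        fix y assume "y \<in> ?B"
        then have "norm ((x + (r / 2) *\<^sub>R e) - y) < r / 4" by (simp add: dist_norm)
        moreover have "norm (x - y) \<le> norm ((x + (r / 2) *\<^sub>R e) - y) + norm ((r / 2) *\<^sub>R e)"
          using norm_triangle_ineq4[of "(x + (r / 2) *\<^sub>R e) - y" "(r / 2) *\<^sub>R e"] by simp
        ultimately show "y \<in> ball x r" using e \<open>0 < r\<close> by (simp add: dist_norm)
      qed
      have fm: "ball x r \<in> lmeasurable" "?B \<in> lmeasurable" by (rule lmeasurable_ball)+
      then have fmA: "A \<inter> ball x r \<in> lmeasurable"
        using A by (metis fmeasurable_Int_fmeasurable inf_commute)
      have "measure lebesgue (A \<inter> ball x r) + measure lebesgue ?B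
          = measure lebesgue ((A \<inter> ball x r) \<union> ?B)"
        using disj fm fmA by (intro measure_Union[symmetric]) (auto simp: fmeasurable_def less_top)
      also have "\<dots> \<le> measure lebesgue (ball x r)"
        using sub fm fmA by (intro measure_mono_fmeasurable) (auto intro: fmeasurableD)
      finally have "measure lebesgue (A \<inter> ball x r) \<le> measure lebesgue (ball x r) - measure lebesgue ?B"
        by simp
      also have "measure lebesgue ?B = \<kappa> * measure lebesgue (ball x r)"
        using \<open>0 < r\<close> by (simp add: content_ball \<kappa>_def power_divide)
      finally have "measure lebesgue (A \<inter> ball x r) \<le> (1 - \<kappa>) * measure lebesgue (ball x r)"
        by (simp add: algebra_simps)
      with gt pos show False by (simp add: pos_less_divide_eq)
    qed
  qed
qed

text \<open>The case \<open>d = 0\<close> is included: a positive real divided by 0 is infinity in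
  \<open>ereal\<close>. Thus bounds on the distance from above and by 0 from below suffice.\<close>

lemma ereal_half_le_divide:
  assumes "0 \<le> d" "d \<le> ereal (2 * a)" "0 < a"
  shows "ereal (1 / 2) \<le> ereal a / d"
proof (cases d)
  case (real s)
  show ?thesis
  proof (cases "s = 0")
    case True
    then show ?thesis using real assms(3) by simp
  next
    case False
    then show ?thesis using real assms by (simp add: field_simps)
  qed
qed (use assms in auto)

lemma frequently_le_Limsup:
  fixes f :: "'a \<Rightarrow> 'b::complete_lattice"
  assumes "\<exists>\<^sub>F x in F. c \<le> f x"
  shows "c \<le> Limsup F f"
  unfolding Limsup_def
proof (rule INF_greatest, elim CollectE)
  fix P assume "eventually P F"
  with assms obtain x where "c \<le> f x" "P x"
    using frequently_ex[OF frequently_eventually_frequently] by blast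
  then show "c \<le> Sup (f ` {x. P x})"
    by (intro SUP_upper2[of x]) auto
qed

text \<open>
  In the balls of radius \<open>r / 4\<close> around \<open>x + (r / 2, 0)\<close> the horizontal displacement from \<open>x\<close>
  exceeds the vertical one, and a set with density point \<open>x\<close> meets them for all small \<open>r\<close>.
\<close>

lemma half_le_ap_Lip:
  fixes x :: "real \<times> real"
  assumes u: "\<forall>\<^sub>F y in nhds x. u y = fst y"
    and d: "\<And>y. 0 \<le> d x y" "\<And>y. d x y \<le> ereal (\<bar>fst x - fst y\<bar> + \<bar>snd x - snd y\<bar>)"
  shows "ereal (1 / 2) \<le> ap_Lip d u x"
  unfolding ap_Lip_def
proof (rule INF_greatest, elim CollectE conjE)
  fix A assume A: "A \<in> sets borel" "point_of_density A x"
  obtain \<rho> where \<rho>: "\<rho> > 0" "\<And>y. dist y x < \<rho> \<Longrightarrow> u y = fst y"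
    using u by (auto simp: eventually_nhds_metric)
  have meets: "\<forall>\<^sub>F r in at_right 0. A \<inter> ball (x + (r / 2) *\<^sub>R (1, 0)) (r / 4) \<noteq> {}"
    using A by (intro point_of_density_meets_ball) (auto simp: norm_prod_def)
  have "\<exists>\<^sub>F y in at x within A. ereal (1 / 2) \<le> ereal \<bar>u x - u y\<bar> / d x y"
    unfolding frequently_def eventually_at
  proof (intro notI, elim exE conjE)
    fix \<sigma> :: real
    assume \<sigma>: "0 < \<sigma>"
      "\<forall>y\<in>A. y \<noteq> x \<and> dist y x < \<sigma> \<longrightarrow> \<not> ereal (1 / 2) \<le> ereal \<bar>u x - u y\<bar> / d x y"
    have "\<forall>\<^sub>F r in at_right 0. 0 < r \<and> r < min \<rho> \<sigma>"
      using \<rho>(1) \<sigma>(1) unfolding eventually_at_right_field by (intro exI[of _ "min \<rho> \<sigma>"]) auto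
    then have "\<exists>r. (0 < r \<and> r < min \<rho> \<sigma>) \<and> A \<inter> ball (x + (r / 2) *\<^sub>R (1, 0)) (r / 4) \<noteq> {}"
      using eventually_conj[OF _ meets] eventually_happens trivial_limit_at_right_real by blast
    then obtain r y where r: "0 < r" "r < \<rho>" "r < \<sigma>"
      and y: "y \<in> A" "dist (x + (r / 2) *\<^sub>R (1, 0)) y < r / 4"
      by auto
    \<comment> \<open>The horizontal displacement exceeds r / 4 and the vertical one stays below it,
      so the l1-distance is at most twice the horizontal displacement.\<close>
    have diff: "\<bar>fst x + r / 2 - fst y\<bar> < r / 4" "\<bar>snd x - snd y\<bar> < r / 4"
      using y(2) dist_fst_le[of "x + (r / 2) *\<^sub>R (1, 0)" y] dist_snd_le[of "x + (r / 2) *\<^sub>R (1, 0)" y]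
      by (auto simp: dist_real_def)
    have "dist (x + (r / 2) *\<^sub>R (1, 0)) x = r / 2"
      using r(1) by (simp add: dist_norm norm_prod_def)
    then have "dist y x < r"
      using y(2) dist_triangle[of y x "x + (r / 2) *\<^sub>R (1, 0)"] r(1)
      unfolding dist_commute[of y "x + _"] by linarith
    then have "u y = fst y" "u x = fst x" "dist y x < \<sigma>"
      using \<rho> r by auto
    moreover have "y \<noteq> x" using diff r(1) by auto
    moreover have "ereal (1 / 2) \<le> ereal \<bar>fst x - fst y\<bar> / d x y"
    proof (rule ereal_half_le_divide[OF d(1) order_trans[OF d(2)]])
      show "ereal (\<bar>fst x - fst y\<bar> + \<bar>snd x - snd y\<bar>) \<le> ereal (2 * \<bar>fst x - fst y\<bar>)"
        using diff by (simp; linarith)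
      show "0 < \<bar>fst x - fst y\<bar>"
        using diff r(1) by linarith
    qed
    ultimately show False using \<sigma>(2) y(1) by auto
  qed
  then show "ereal (1 / 2) \<le> Limsup (at x within A) (\<lambda>y. ereal \<bar>u x - u y\<bar> / d x y)"
    by (rule frequently_le_Limsup)
qed

subsection \<open>Energy densities and the intrinsic distance\<close>

text \<open>Uniqueness of Radon-Nikodym derivatives, used for the energy density, takes place over a
  sigma-finite measure.\<close>

lemma sigma_finite_lebesgue: "sigma_finite_measure (lebesgue :: 'a::euclidean_space measure)"
proof
  obtain A :: "'a set set" where "countable A" "A \<subseteq> sets lborel" "\<Union>A = space lborel"
    "\<forall>a\<in>A. emeasure lborel a \<noteq> \<infinity>"
    using lborel.sigma_finite_countable by blast
  then show "\<exists>A :: 'a set set. countable A \<and> A \<subseteq> sets lebesgue \<and> \<Union>A = space lebesgue \<and>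
      (\<forall>a\<in>A. emeasure lebesgue a \<noteq> \<infinity>)"
    by (intro exI[of _ A]) (auto simp: subset_eq)
qed

lemma has_weak_gradient_weak_gradient:
  "has_weak_gradient u g \<Longrightarrow> has_weak_gradient u (weak_gradient u)"
  unfolding weak_gradient_def by (rule someI[of "has_weak_gradient u"])

lemma compact_cantor_E: "compact cantor_E"
  unfolding cantor_E_def by (intro compact_Times compact_cantor_F)

text \<open>The energy measure is given by a density, which its Radon-Nikodym derivative recovers
  almost everywhere; the chosen gradient is then exchanged for an arbitrary
  \<open>g\<close>.\<close>

lemma energy_density_AE:
  assumes "has_weak_gradient u g"
  shows "AE x in lebesgue. energy_density \<delta> u x
    = ennreal ((1 - \<delta> * indicator cantor_E x) * (norm (g x))\<^sup>2)"
proof -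
  interpret sigma_finite_measure "lebesgue :: (real \<times> real) measure"
    by (rule sigma_finite_lebesgue)
  note wg = has_weak_gradient_weak_gradient[OF assms]
  have "weak_gradient u \<in> borel_measurable lebesgue"
    using wg by (auto simp: has_weak_gradient_def intro: locally_integrable_measurable)
  moreover have "cantor_E \<in> sets lebesgue"
    using compact_cantor_E by (simp add: borel_compact)
  ultimately have "(\<lambda>x. ennreal ((1 - \<delta> * indicator cantor_E x) * (norm (weak_gradient u x))\<^sup>2))
      \<in> borel_measurable lebesgue"
    by measurable
  from RN_deriv_unique[OF this refl]
  have "AE x in lebesgue. ennreal ((1 - \<delta> * indicator cantor_E x) * (norm (weak_gradient u x))\<^sup>2)
      = energy_density \<delta> u x"
    by (simp add: energy_density_def energy_measure_def)
  with has_weak_gradient_AE_unique[OF assms wg] show ?thesis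
    by eventually_elim simp
qed

text \<open>The zero function is admissible in the supremum.\<close>

lemma intrinsic_dist_nonneg: "0 \<le> intrinsic_dist \<delta> x y"
proof -
  let ?z = "\<lambda>_::real \<times> real. 0 :: real"
  have z: "has_weak_gradient ?z (\<lambda>_. 0)"
    by (simp add: has_weak_gradient_def locally_integrable_def)
  have "AE z in lebesgue. energy_density \<delta> ?z z \<le> 1"
    using energy_density_AE[OF z, of \<delta>] by eventually_elim simp
  moreover have "?z \<in> W12_loc"
    using z by (auto simp: W12_loc_def L2_loc_def intro!: exI[of _ "\<lambda>_. 0"])
  ultimately show ?thesis
    unfolding intrinsic_dist_def by (intro SUP_upper2[of ?z]) auto
qed

text \<open>Good lines joined at a corner give the l1-distance along a path with one bend, and
  density with continuity removes the restriction on the end points.\<close>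

lemma lipschitz_if_lipschitz_on_dense_lines:
  fixes u :: "real \<times> real \<Rightarrow> real"
  assumes cont: "continuous_on UNIV u"
    and dense: "\<And>p q. p < q \<Longrightarrow> \<exists>t. p < t \<and> t < q \<and> t \<in> G"
    and vert: "\<And>t c d. t \<in> G \<Longrightarrow> \<bar>u (t, c) - u (t, d)\<bar> \<le> \<bar>c - d\<bar>"
    and horiz: "\<And>t c d. t \<in> G \<Longrightarrow> \<bar>u (c, t) - u (d, t)\<bar> \<le> \<bar>c - d\<bar>"
  shows "\<bar>u x - u y\<bar> \<le> \<bar>fst x - fst y\<bar> + \<bar>snd x - snd y\<bar>"
proof -
  have approx: "\<exists>f. (\<forall>n. f n \<in> G) \<and> f \<longlonglongrightarrow> s" for s
  proof -
    have "\<exists>t. s < t \<and> t < s + inverse (real (Suc n)) \<and> t \<in> G" for n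
      by (rule dense) simp
    then obtain f where f: "\<And>n. s < f n" "\<And>n. f n < s + inverse (real (Suc n))" "\<And>n. f n \<in> G"
      by metis
    have "f \<longlonglongrightarrow> s"
      by (rule tendsto_sandwich[OF _ _ tendsto_const LIMSEQ_inverse_real_of_nat_add])
        (use f in \<open>auto intro!: eventuallyI less_imp_le\<close>)
    with f(3) show ?thesis by blast
  qed
  obtain a b where a: "\<And>n. a n \<in> G" "a \<longlonglongrightarrow> fst x" and b: "\<And>n. b n \<in> G" "b \<longlonglongrightarrow> snd y"
    using approx by metis
  have u_lim: "(\<lambda>n. u (f n)) \<longlonglongrightarrow> u l" if "f \<longlonglongrightarrow> l" for f l
  proof (rule isCont_tendsto_compose[OF _ that])
    show "isCont u l" using cont by (cases l) (simp add: continuous_on_eq_continuous_at)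
  qed
  show ?thesis
  proof (rule LIMSEQ_le)
    show "(\<lambda>n. \<bar>u (a n, snd x) - u (fst y, b n)\<bar>) \<longlonglongrightarrow> \<bar>u x - u y\<bar>"
      using u_lim[OF tendsto_Pair[OF a(2) tendsto_const[of "snd x"]]]
        u_lim[OF tendsto_Pair[OF tendsto_const[of "fst y"] b(2)]]
      by (intro tendsto_intros) simp_all
    show "(\<lambda>n. \<bar>a n - fst y\<bar> + \<bar>snd x - b n\<bar>) \<longlonglongrightarrow> \<bar>fst x - fst y\<bar> + \<bar>snd x - snd y\<bar>"
      by (intro tendsto_intros a b)
    show "\<exists>N. \<forall>n\<ge>N. \<bar>u (a n, snd x) - u (fst y, b n)\<bar> \<le> \<bar>a n - fst y\<bar> + \<bar>snd x - b n\<bar>"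
    proof (intro exI allI impI)
      fix n
      show "\<bar>u (a n, snd x) - u (fst y, b n)\<bar> \<le> \<bar>a n - fst y\<bar> + \<bar>snd x - b n\<bar>"
        \<comment> \<open>The corner is \<open>(a n, b n)\<close>: it is reached vertically over
          \<open>a n\<close> and left horizontally at height \<open>b n\<close>.\<close>
        using vert[OF a(1), of n "snd x" "b n"] horiz[OF b(1), of "a n" n "fst y"] by linarith
    qed
  qed
qed

lemma intrinsic_dist_le:
  "intrinsic_dist \<delta> x y \<le> ereal (\<bar>fst x - fst y\<bar> + \<bar>snd x - snd y\<bar>)"
  unfolding intrinsic_dist_def
proof (rule SUP_least, elim CollectE conjE)
  fix u :: "real \<times> real \<Rightarrow> real"
  assume "u \<in> W12_loc" and cont: "continuous_on UNIV u"
    and energy: "AE z in lebesgue. energy_density \<delta> u z \<le> 1"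
  then obtain g where g: "has_weak_gradient u g" by (auto simp: W12_loc_def)
  \<comment> \<open>Off E the weight in the energy density is 1, so admissibility bounds the
    gradient itself, whatever \<delta> is.\<close>
  have bound: "AE z in lebesgue. z \<notin> cantor_E \<longrightarrow> norm (g z) \<le> 1"
    using energy energy_density_AE[OF g, of \<delta>]
    by eventually_elim (auto simp: ennreal_le_1 power_le_one_iff abs_square_le_1)
  have line: "\<bar>u (t *\<^sub>R i + c *\<^sub>R j) - u (t *\<^sub>R i + d *\<^sub>R j)\<bar> \<le> \<bar>c - d\<bar>"
    if t: "t \<in> - cantor_F" and ij: "(i, j) = ((1, 0), (0, 1)) \<or> (i, j) = ((0, 1), (1, 0))"
    for t c d and i j :: "real \<times> real"
  proof -
    have bound': "AE z in lebesgue. z \<bullet> i \<in> - cantor_F \<longrightarrow> norm (g z) \<le> 1"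
      using bound
    proof eventually_elim
      case (elim z)
      have "z \<bullet> i = fst z \<or> z \<bullet> i = snd z" using ij by (auto simp: inner_prod_def)
      with elim show ?case by (auto simp: cantor_E_def mem_Times_iff)
    qed
    \<comment> \<open>The complement of F serves as \<open>T\<close>: a point with one coordinate in
      it is outside E, whichever coordinate that is.\<close>
    have "open (- cantor_F)"
      using compact_cantor_F by (simp add: compact_imp_closed open_Compl)
    note * = weak_gradient_line_bound[OF ij cont g this t bound']
    show ?thesis
      using *[of c d] *[of d c] by (cases c d rule: linorder_cases) (auto simp: abs_minus_commute)
  qed
  have "\<bar>u x - u y\<bar> \<le> \<bar>fst x - fst y\<bar> + \<bar>snd x - snd y\<bar>"
  proof (rule lipschitz_if_lipschitz_on_dense_lines[OF cont])
    show "\<exists>t. p < t \<and> t < q \<and> t \<in> - cantor_F" if "p < q" for p q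
      using cantor_F_gap[OF that] by auto
    fix t c d assume "t \<in> - cantor_F"
    then show "\<bar>u (t, c) - u (t, d)\<bar> \<le> \<bar>c - d\<bar>" "\<bar>u (c, t) - u (d, t)\<bar> \<le> \<bar>c - d\<bar>"
      using line[of t "(1, 0)" "(0, 1)" c d] line[of t "(0, 1)" "(1, 0)" c d] by simp_all
  qed
  then show "ereal (u x - u y) \<le> ereal (\<bar>fst x - fst y\<bar> + \<bar>snd x - snd y\<bar>)"
    by simp
qed

section \<open>The witness function and the set of positive measure\<close>

lemma emeasure_cantor_E_pos: "0 < emeasure lebesgue cantor_E"
proof -
  have F: "cantor_F \<in> sets borel" using compact_cantor_F by (rule borel_compact)
  have "emeasure lebesgue cantor_E = emeasure (lborel \<Otimes>\<^sub>M lborel) (cantor_F \<times> cantor_F)"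
    using compact_cantor_E by (simp add: lborel_prod borel_compact cantor_E_def)
  also have "\<dots> = emeasure lborel cantor_F * emeasure lborel cantor_F"
    using F by (intro lborel.emeasure_pair_measure_Times) auto
  also have "\<dots> > 0"
    using emeasure_cantor_F_pos by (simp add: ennreal_zero_less_mult_iff)
  finally show ?thesis .
qed

text \<open>Agreement on an open neighbourhood of the unit square makes gradients and difference
  quotients those of \<open>fst\<close> even at points of E on the boundary. The shifts 2 and 3 make
  the cut-off 1 on [-1, 2] and 0 outside [-2, 3].\<close>

lemma test_function_eq_fst_near_unit_square:
  obtains u :: "real \<times> real \<Rightarrow> real" where "test_function u"
    "\<And>z. z \<in> {-1<..<2} \<times> {-1<..<2} \<Longrightarrow> u z = fst z"
proof -
  obtain h h' :: "real \<Rightarrow> real" where h: "\<And>k. C_k k h"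
    "\<And>t. (h has_real_derivative h' t) (at t)" "\<And>t. 0 \<le> h' t" "continuous_on UNIV h'"
    "\<And>t. 0 \<le> h t" "\<And>t. h t \<le> 1" "\<And>t. t \<le> 0 \<Longrightarrow> h t = 0" "\<And>t. t \<ge> 1 \<Longrightarrow> h t = 1"
    using smooth_step_exists by blast
  define f where "f s = h (s + 2) * h (- s + 3)" for s
  have Cf: "C_k k f" for k
    unfolding f_def[abs_def]
    using C_k_affine[OF h(1) bounded_linear_ident, of k 2]
      C_k_affine[OF h(1) bounded_linear_minus[OF bounded_linear_ident], of k 3]
    by (rule C_k_mult)
  have C_fst: "C_k k (\<lambda>z::real \<times> real. fst z)" for k
  proof (cases k)
    case (Suc m)
    show ?thesis
      unfolding Suc by (rule C_k_SucI[where f' = "\<lambda>_ v. fst v"])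
        (auto intro: bounded_linear_imp_has_derivative bounded_linear_fst)
  qed (simp add: linear_continuous_on bounded_linear_fst)
  show ?thesis
  proof (rule that[of "\<lambda>z. fst z * (f (fst z) * f (snd z))"])
    show "test_function (\<lambda>z. fst z * (f (fst z) * f (snd z)))"
    proof (rule test_functionI[of _ "cbox (-2, -2) (3, 3)"])
      show "C_k k (\<lambda>z. fst z * (f (fst z) * f (snd z)))" for k
        using C_k_affine[OF Cf bounded_linear_fst, of k 0] C_k_affine[OF Cf bounded_linear_snd, of k 0]
        by (intro C_k_mult C_fst) simp_all
      have f0: "f s = 0" if "s < -2 \<or> s > 3" for s
        using that h(7) by (auto simp: f_def)
      show "fst z * (f (fst z) * f (snd z)) = 0" if "z \<notin> cbox (-2, -2) (3, 3)" for z
        using that f0[of "fst z"] f0[of "snd z"] by (cases z) (auto simp: cbox_Pair_eq not_le)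
    qed simp
    have f1: "f s = 1" if "-1 < s" "s < 2" for s
      using that h(8) by (simp add: f_def)
    show "fst z * (f (fst z) * f (snd z)) = fst z" if "z \<in> {-1<..<2} \<times> {-1<..<2}" for z
      using that f1 by (cases z) auto
  qed
qed

theorem proposition3p1:
  shows "\<exists>\<delta>\<^sub>E::real. 0 < \<delta>\<^sub>E \<and> \<delta>\<^sub>E < 1 \<and>
    (\<forall>\<delta>. \<delta>\<^sub>E < \<delta> \<and> \<delta> < 1 \<longrightarrow>
      (\<exists>u\<in>W12. \<exists>S\<in>sets lebesgue. emeasure lebesgue S > 0 \<and>
        (\<forall>x\<in>S. enn2ereal (energy_density \<delta> u x) < (ap_Lip (intrinsic_dist \<delta>) u x)\<^sup>2)))"
\<comment> \<open>The threshold is 3/4 because \<open>1 - \<delta>\<close> must fall below the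
  square of the lower bound 1/2.\<close>
proof (rule exI[of _ "3 / 4"], intro conjI allI impI)
  fix \<delta> :: real assume \<delta>: "3 / 4 < \<delta> \<and> \<delta> < 1"
  obtain u :: "real \<times> real \<Rightarrow> real" where u: "test_function u"
    "\<And>z. z \<in> {-1<..<2} \<times> {-1<..<2} \<Longrightarrow> u z = fst z"
    using test_function_eq_fst_near_unit_square by blast
  have E_sub: "cantor_E \<subseteq> {-1<..<2} \<times> {-1<..<2}"
    using cantor_F_subset by (force simp: cantor_E_def)
  have eq_fst: "\<forall>\<^sub>F y in nhds x. u y = fst y" if "x \<in> cantor_E" for x
    using that E_sub u(2) unfolding eventually_nhds
    by (intro exI[of _ "{-1<..<2} \<times> {-1<..<2}"]) (auto intro!: open_Times)
  have grad: "norm (classical_gradient u x) = 1" if x: "x \<in> cantor_E" for x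
  proof -
    have "(u has_derivative fst) (at x)"
      by (rule has_derivative_transform_within_open[of fst _ _ _ "{-1<..<2} \<times> {-1<..<2}"])
        (use x E_sub u(2) in \<open>auto intro!: open_Times bounded_linear_imp_has_derivative bounded_linear_fst\<close>)
    then have "classical_gradient u x \<bullet> v = (1, 0) \<bullet> v" for v
      using classical_gradient_inner[OF test_function_derivative(1)[OF u(1)], of x v]
      by (simp add: frechet_derivative_eqI inner_prod_def)
    then have "classical_gradient u x = (1, 0)"
      using vector_eq_rdot by blast
    then show ?thesis by (simp add: norm_prod_def)
  qed
  have "AE x in lebesgue. x \<in> cantor_E \<longrightarrow> energy_density \<delta> u x = ennreal (1 - \<delta>)"
    using energy_density_AE[OF test_function_has_weak_gradient[OF u(1)], of \<delta>]
    by eventually_elim (simp add: grad)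
  \<comment> \<open>The inequality is demanded at every point of the set, so the exceptional null
    set is removed from E, which costs no measure.\<close>
  then obtain N where N: "N \<in> null_sets lebesgue"
    "{x \<in> space lebesgue. \<not> (x \<in> cantor_E \<longrightarrow> energy_density \<delta> u x = ennreal (1 - \<delta>))} \<subseteq> N"
    by (auto simp: eventually_ae_filter)
  have E_sets: "cantor_E \<in> sets lebesgue"
    using compact_cantor_E by (simp add: borel_compact)
  show "\<exists>u\<in>W12. \<exists>S\<in>sets lebesgue. emeasure lebesgue S > 0 \<and>
      (\<forall>x\<in>S. enn2ereal (energy_density \<delta> u x) < (ap_Lip (intrinsic_dist \<delta>) u x)\<^sup>2)"
  proof (intro bexI[of _ u] bexI[of _ "cantor_E - N"] conjI ballI)
    show "u \<in> W12" by (rule test_function_W12[OF u(1)])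
    show "cantor_E - N \<in> sets lebesgue" using E_sets N(1) by auto
    show "0 < emeasure lebesgue (cantor_E - N)"
      using emeasure_cantor_E_pos by (simp add: emeasure_Diff_null_set[OF N(1) E_sets])
    fix x assume "x \<in> cantor_E - N"
    then have x: "x \<in> cantor_E" and "energy_density \<delta> u x = ennreal (1 - \<delta>)"
      using N(2) by auto
    then have "enn2ereal (energy_density \<delta> u x) = ereal (1 - \<delta>)"
      using \<delta> by (simp add: enn2ereal_ennreal)
    also have "\<dots> < ereal (1 / 4)" using \<delta> by simp
    also have "\<dots> = ereal (1 / 2) * ereal (1 / 2)" by simp
    also have "\<dots> \<le> (ap_Lip (intrinsic_dist \<delta>) u x)\<^sup>2"
    proof -
      have half: "ereal (1 / 2) \<le> ap_Lip (intrinsic_dist \<delta>) u x"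
        by (intro half_le_ap_Lip eq_fst x intrinsic_dist_nonneg intrinsic_dist_le)
      moreover have "0 \<le> ereal (1 / 2)" by simp
      ultimately show ?thesis
        unfolding power2_eq_square
        by (intro ereal_mult_mono half order_trans[OF _ half]) simp_all
    qed
    finally show "enn2ereal (energy_density \<delta> u x) < (ap_Lip (intrinsic_dist \<delta>) u x)\<^sup>2" .
  qed
qed simp_all

end
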